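(* Let $G$ be a locally compact abelian group which has an open subgroup $G_0$ with $G_0\cong\mathbf{R}^m\times K$ for some $m\in\mathbf{Z}_+$ and some compact group $K$, and such that $G/G_0\cong\mathbf{Z}^k\times F$ for some $k\in\mathbf{Z}_+$ and some torsion group $F$. Let $X$ be a locally convex topological vector space over $\mathbf{C}$. Then: (a) $P^n(G)$ is finite dimensional for each $n\in\mathbf{Z}_+$. (b) If moreover $F$ is of bounded order, then for each $n\in\mathbf{Z}_+$ and each $p\in P^n(G,X)$ there exist finitely many $p_1,\dots,p_l\in P^n(G,X)$ and $q_1,\dots,q_l\in P^n(G)$ with $q_j(0)=0$ such that $\Delta_h p(t)=\sum_{j=1}^{l}p_j(t)q_j(h)$ for all $h,t\in G$.
   Context: $\mathbf{Z}_+=\{0,1,2,\dots\}$. $\Delta_h p(t)=p(t+h)-p(t)$. A group is torsion if every element has finite order, and of bounded order if the orders of its elements are bounded. For an abelian topological group $S$ and a topological vector space $X$, a continuous $p:S\to X$ is a polynomial of degree at most $n$ if for all $s,t\in S$ the map $m\mapsto p(s+mt)$, $m\in\mathbf{Z}_+$, is a polynomial in $m$ of degree at most $n$ with coefficients in $X$; $P^n(S,X)$ is the space of these and $P^n(S)=P^n(S,\mathbf{C})$. *)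

theory Defs
  imports "HOL-Analysis.Analysis" "HOL-Algebra.Product_Groups" "HOL-Algebra.Elementary_Groups"
begin

definition add_grp :: "'a::ab_group_add monoid" where
  "add_grp = \<lparr>carrier = UNIV, monoid.mult = (+), one = 0\<rparr>"

definition natmul :: "nat \<Rightarrow> 'a::ab_group_add \<Rightarrow> 'a" where
  "natmul m t = (\<Sum>i<m. t)"

definition ab_top_group :: "'a::ab_group_add topology \<Rightarrow> bool" where
  "ab_top_group T \<longleftrightarrow> topspace T = UNIV \<and> Hausdorff_space T \<and>
     continuous_map (prod_topology T T) T (\<lambda>(x, y). x + y) \<and>
     continuous_map T T uminus"

definition complex_vs :: "(complex \<Rightarrow> 'x::ab_group_add \<Rightarrow> 'x) \<Rightarrow> bool" where
  "complex_vs sm \<longleftrightarrow>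
     (\<forall>a x y. sm a (x + y) = sm a x + sm a y) \<and>
     (\<forall>a b x. sm (a + b) x = sm a x + sm b x) \<and>
     (\<forall>a b x. sm (a * b) x = sm a (sm b x)) \<and>
     (\<forall>x. sm 1 x = x)"

definition convex_set_vs :: "(complex \<Rightarrow> 'x::ab_group_add \<Rightarrow> 'x) \<Rightarrow> 'x set \<Rightarrow> bool" where
  "convex_set_vs sm V \<longleftrightarrow> (\<forall>x\<in>V. \<forall>y\<in>V. \<forall>u::real. 0 \<le> u \<and> u \<le> 1 \<longrightarrow>
      sm (complex_of_real u) x + sm (complex_of_real (1 - u)) y \<in> V)"

definition locally_convex_tvs :: "'x::ab_group_add topology \<Rightarrow> (complex \<Rightarrow> 'x \<Rightarrow> 'x) \<Rightarrow> bool" where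
  "locally_convex_tvs T sm \<longleftrightarrow> complex_vs sm \<and> topspace T = UNIV \<and> Hausdorff_space T \<and>
     continuous_map (prod_topology T T) T (\<lambda>(x, y). x + y) \<and>
     continuous_map (prod_topology euclidean T) T (\<lambda>(a, x). sm a x) \<and>
     (\<forall>U. openin T U \<and> 0 \<in> U \<longrightarrow>
        (\<exists>V. openin T V \<and> 0 \<in> V \<and> V \<subseteq> U \<and> convex_set_vs sm V))"

definition poly_space ::
  "'s::ab_group_add topology \<Rightarrow> 'x::ab_group_add topology \<Rightarrow> (complex \<Rightarrow> 'x \<Rightarrow> 'x) \<Rightarrow> nat
     \<Rightarrow> ('s \<Rightarrow> 'x) set" where
  "poly_space TS TX sm n = {p. continuous_map TS TX p \<and>
     (\<forall>s t. \<exists>c::nat \<Rightarrow> 'x. \<forall>m::nat.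
        p (s + natmul m t) = (\<Sum>j\<le>n. sm (of_nat m ^ j) (c j)))}"

abbreviation scalar_poly_space :: "'s::ab_group_add topology \<Rightarrow> nat \<Rightarrow> ('s \<Rightarrow> complex) set" where
  "scalar_poly_space TS n \<equiv> poly_space TS euclidean (*) n"

text \<open>R^m realised as the functions nat \<Rightarrow> real vanishing from index m on.\<close>
definition Rpow :: "nat \<Rightarrow> (nat \<Rightarrow> real) set" where
  "Rpow m = {x. \<forall>i\<ge>m. x i = 0}"

end

theory Submission
  imports Defs "HOL-Computational_Algebra.Polynomial"
begin

text \<open>Choosing lifts of a basis of \<open>\<int>^k\<close> and extending the \<open>\<real>^m\<close>-coordinates of \<open>G0\<close> by
  divisibility, one gets \<open>k + m\<close> continuous additive coordinates \<open>G \<rightarrow> \<real>\<close>, whose common kernel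
  consists of elements with a nonzero multiple in the compact group \<open>K\<close>. A vector-valued polynomial in
  \<open>j \<in> \<nat>\<close> with values in a compact set is constant, hence every polynomial on \<open>G\<close> is invariant under that
  kernel. Along each coordinate line it is determined by its values at \<open>0, \<dots>, n\<close> (Lagrange
  interpolation at rational points, then continuity), so \<open>p (t + h)\<close> is a sum of monomials in the
  coordinates of \<open>h\<close> whose coefficients are combinations of translates of \<open>p\<close>. This gives (a);
  comparing powers of \<open>j\<close> in \<open>p (t + j h)\<close> removes the monomials of degree above \<open>n\<close> and gives (b).\<close>

section \<open>Lagrange interpolation at the nodes 0, ..., n\<close>

text \<open>\<open>A e i\<close> is the coefficient of \<open>x ^ e\<close> in the Lagrange basis
  polynomial of the node \<open>i\<close>; expanding \<open>x ^ j\<close> in that basis and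
  comparing coefficients gives the identity. Row \<open>e\<close> thus reads the coefficient of
  degree \<open>e\<close> off the values at the nodes.\<close>

lemma vandermonde_inverse:
  fixes n :: nat
  obtains A :: "nat \<Rightarrow> nat \<Rightarrow> complex"
  where "\<And>e j. e \<le> n \<Longrightarrow> j \<le> n \<Longrightarrow> (\<Sum>i\<le>n. A e i * of_nat i ^ j) = (if e = j then 1 else 0)"
proof -
  define L :: "nat \<Rightarrow> complex poly" where
    "L i = (\<Prod>l\<in>{..n} - {i}. smult (inverse (of_nat i - of_nat l)) [:- of_nat l, 1:])" for i
  have val: "poly (L i) (of_nat l) = (if l = i then 1 else 0)" if "i \<le> n" "l \<le> n" for i l
  proof (cases "l = i")
    case True
    have "poly (L i) (of_nat i) = (\<Prod>l\<in>{..n} - {i}. 1)"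
      unfolding L_def poly_prod
    proof (rule prod.cong)
      fix l assume "l \<in> {..n} - {i}"
      then have "inverse (of_nat i - of_nat l) * (of_nat i - of_nat l) = (1 :: complex)" by simp
      then show "poly (smult (inverse (of_nat i - of_nat l)) [:- of_nat l, 1:]) (of_nat i) = (1 :: complex)"
        by (simp add: algebra_simps)
    qed simp
    then show ?thesis using True by simp
  next
    case False
    then show ?thesis using that by (auto simp: L_def poly_prod intro!: bexI[of _ l])
  qed
  have deg: "degree (L i) \<le> n" if "i \<le> n" for i
  proof -
    have "degree (L i) \<le> (\<Sum>l\<in>{..n} - {i}. degree (smult (inverse (of_nat i - of_nat l :: complex)) [:- of_nat l, 1:]))"
      unfolding L_def using degree_prod_sum_le[of "{..n} - {i}"
          "\<lambda>l. smult (inverse (of_nat i - of_nat l :: complex)) [:- of_nat l, 1:]"] by (simp add: o_def)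
    also have "\<dots> \<le> (\<Sum>l\<in>{..n} - {i}. 1)"
      by (intro sum_mono) auto
    finally show ?thesis using that by simp
  qed
  \<comment> \<open>Both sides have degree at most \<open>n\<close> and agree at the
    \<open>n + 1\<close> nodes.\<close>
  have eq: "(\<Sum>i\<le>n. smult (of_nat i ^ j) (L i)) = monom 1 j" if j: "j \<le> n" for j
  proof (rule poly_eqI_degree[where A = "of_nat ` {..n}"])
    fix x :: complex assume "x \<in> of_nat ` {..n}"
    then obtain l where l: "l \<le> n" "x = of_nat l" by auto
    have "poly (\<Sum>i\<le>n. smult (of_nat i ^ j) (L i)) x = (\<Sum>i\<le>n. if l = i then of_nat i ^ j else 0)"
      unfolding poly_sum using l by (intro sum.cong) (auto simp: val)
    then show "poly (\<Sum>i\<le>n. smult (of_nat i ^ j) (L i)) x = poly (monom 1 j) x"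
      using l by (simp add: poly_monom)
  next
    have c: "card ((of_nat :: nat \<Rightarrow> complex) ` {..n}) = Suc n"
      by (subst card_image) (auto intro: inj_onI)
    have "degree (\<Sum>i\<le>n. smult (of_nat i ^ j) (L i)) \<le> n"
      by (intro degree_sum_le) (auto simp: deg)
    then show "degree (\<Sum>i\<le>n. smult (of_nat i ^ j) (L i)) < card ((of_nat :: nat \<Rightarrow> complex) ` {..n})"
      using c by simp
    show "degree (monom (1 :: complex) j) < card ((of_nat :: nat \<Rightarrow> complex) ` {..n})"
      using c j by (simp add: degree_monom_eq)
  qed
  show ?thesis
  proof
    fix e j assume "e \<le> n" "j \<le> n"
    have "(\<Sum>i\<le>n. poly.coeff (L i) e * of_nat i ^ j) = poly.coeff (\<Sum>i\<le>n. smult (of_nat i ^ j) (L i)) e"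
      by (simp add: coeff_sum mult.commute)
    also have "\<dots> = (if e = j then 1 else 0)"
      using eq[OF \<open>j \<le> n\<close>] by (simp add: coeff_monom)
    finally show "(\<Sum>i\<le>n. poly.coeff (L i) e * of_nat i ^ j) = (if e = j then 1 else 0)" .
  qed
qed

lemma poly_eq_sum_coeff_atMost:
  fixes P :: "'a::comm_semiring_1 poly"
  assumes "degree P \<le> n"
  shows "poly P x = (\<Sum>j\<le>n. poly.coeff P j * x ^ j)"
proof -
  have "(\<Sum>j\<le>degree P. poly.coeff P j * x ^ j) = (\<Sum>j\<le>n. poly.coeff P j * x ^ j)"
    by (rule sum.mono_neutral_left) (use assms in \<open>auto simp: coeff_eq_0\<close>)
  then show ?thesis by (simp add: poly_altdef)
qed

text \<open>In \<open>y\<close> the power is a polynomial of degree at most \<open>n\<close>, so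
  \<open>A\<close> recovers its coefficients from the values at \<open>y = 0, ..., n\<close>. The
  affine form allows progressions of any step and start to be compared with the integer
  nodes.\<close>

lemma affine_power_interpolation:
  fixes A :: "nat \<Rightarrow> nat \<Rightarrow> complex"
  assumes A: "\<And>e j. e \<le> n \<Longrightarrow> j \<le> n \<Longrightarrow> (\<Sum>i\<le>n. A e i * of_nat i ^ j) = (if e = j then 1 else 0)"
    and j: "j \<le> n"
  shows "(a * y + b) ^ j = (\<Sum>e\<le>n. y ^ e * (\<Sum>i\<le>n. A e i * (a * of_nat i + b) ^ j))"
proof -
  define P where "P = [:b, a:] ^ j"
  have "degree P \<le> n"
    unfolding P_def using degree_power_le[of "[:b, a:]" j] j by (auto split: if_splits)
  then have P: "(a * x + b) ^ j = (\<Sum>l\<le>n. poly.coeff P l * x ^ l)" for x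
    using poly_eq_sum_coeff_atMost[of P n x] by (simp add: P_def algebra_simps)
  have "(\<Sum>i\<le>n. A e i * (a * of_nat i + b) ^ j) = poly.coeff P e" if e: "e \<le> n" for e
  proof -
    have "(\<Sum>i\<le>n. A e i * (a * of_nat i + b) ^ j) = (\<Sum>l\<le>n. poly.coeff P l * (\<Sum>i\<le>n. A e i * of_nat i ^ l))"
      unfolding P sum_distrib_left by (subst sum.swap) (simp add: mult_ac)
    also have "\<dots> = (\<Sum>l\<le>n. if e = l then poly.coeff P l else 0)"
      by (rule sum.cong) (use e A in auto)
    finally show ?thesis using e by simp
  qed
  then show ?thesis by (simp add: P mult.commute)
qed

section \<open>Continuity of complex products; multiples in abelian groups\<close>

lemma continuous_map_mult_complex:
  "continuous_map (prod_topology euclidean euclidean) euclidean (\<lambda>(a, x). a * x :: complex)"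
  unfolding prod_topology_euclidean case_prod_beta by (auto intro!: continuous_intros)

lemma continuous_map_times_complex:
  fixes f g :: "'a \<Rightarrow> complex"
  assumes "continuous_map T euclidean f" "continuous_map T euclidean g"
  shows "continuous_map T euclidean (\<lambda>x. f x * g x)"
  using continuous_map_compose[OF continuous_map_pairedI[OF assms] continuous_map_mult_complex] by (simp add: o_def)

lemma natmul_0 [simp]: "natmul 0 t = 0"
  and natmul_Suc [simp]: "natmul (Suc i) t = t + natmul i t"
  by (simp_all add: natmul_def add.commute)

lemma natmul_add: "natmul (i + j) t = natmul i t + natmul j t"
  by (induction i) (simp_all add: add.assoc)

lemma natmul_mult: "natmul (i * j) t = natmul i (natmul j t)"
  by (induction i) (simp_all add: natmul_add)

lemma natmul_add_right: "natmul i (s + t) = natmul i s + natmul i t"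
  by (simp add: natmul_def sum.distrib)

lemma natmul_diff_right: "natmul i (s - t) = natmul i s - natmul i t"
  by (simp add: natmul_def sum_subtractf)

lemma natmul_real [simp]: "natmul i (x :: real) = real i * x"
  by (simp add: natmul_def)

lemma (in additive) natmul: "f (natmul i t) = natmul i (f t)"
  by (simp add: natmul_def sum)

section \<open>Vector-valued polynomials in a natural number variable\<close>

locale complex_tvs =
  fixes TX :: "'x::ab_group_add topology" and sm :: "complex \<Rightarrow> 'x \<Rightarrow> 'x"
  assumes vs: "complex_vs sm"
    and top_X: "topspace TX = UNIV"
    and Hausdorff_X: "Hausdorff_space TX"
    and cont_add: "continuous_map (prod_topology TX TX) TX (\<lambda>(x, y). x + y)"
    and cont_scale: "continuous_map (prod_topology euclidean TX) TX (\<lambda>(a, x). sm a x)"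

sublocale complex_tvs \<subseteq> vector_space sm
  using vs by unfold_locales (auto simp: complex_vs_def)

context complex_tvs
begin

lemma continuous_map_plus:
  assumes "continuous_map T TX f" "continuous_map T TX g"
  shows "continuous_map T TX (\<lambda>x. f x + g x)"
  using continuous_map_compose[OF continuous_map_pairedI[OF assms] cont_add] by (simp add: o_def)

lemma continuous_map_scale:
  assumes "continuous_map T euclidean f" "continuous_map T TX g"
  shows "continuous_map T TX (\<lambda>x. sm (f x) (g x))"
  using continuous_map_compose[OF continuous_map_pairedI[OF assms] cont_scale] by (simp add: o_def)

lemma continuous_map_sum_scale:
  assumes "\<And>i. i \<in> I \<Longrightarrow> continuous_map T euclidean (f i)" "\<And>i. i \<in> I \<Longrightarrow> continuous_map T TX (g i)"
  shows "continuous_map T TX (\<lambda>x. \<Sum>i\<in>I. sm (f i x) (g i x))"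
  using assms
  by (induction I rule: infinite_finite_induct) (auto simp: top_X intro!: continuous_map_plus continuous_map_scale)

text \<open>Interchanging the sums reduces this to the scalar identity for \<open>A\<close>.
  Coefficients are fixed combinations of the first \<open>n + 1\<close> values, which yields their
  uniqueness.\<close>

lemma poly_coeff_recover:
  assumes "\<And>e j. e \<le> n \<Longrightarrow> j \<le> n \<Longrightarrow> (\<Sum>i\<le>n. A e i * of_nat i ^ j) = (if e = j then 1 else 0)"
    and "e \<le> n"
  shows "(\<Sum>i\<le>n. sm (A e i) (\<Sum>j\<le>n. sm (of_nat i ^ j) (c j))) = c e"
proof -
  have "(\<Sum>i\<le>n. sm (A e i) (\<Sum>j\<le>n. sm (of_nat i ^ j) (c j))) =
      (\<Sum>j\<le>n. sm (\<Sum>i\<le>n. A e i * of_nat i ^ j) (c j))"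
    unfolding scale_sum_right scale_sum_left scale_scale by (rule sum.swap)
  also have "\<dots> = (\<Sum>j\<le>n. if e = j then c j else 0)"
    by (rule sum.cong) (use assms in auto)
  finally show ?thesis using assms(2) by simp
qed

lemma poly_coeff_unique:
  assumes "\<And>m. (\<Sum>j\<le>n. sm (of_nat m ^ j) (c j)) = (\<Sum>j\<le>n. sm (of_nat m ^ j) (d j))" "e \<le> n"
  shows "c e = d e"
proof -
  obtain A :: "nat \<Rightarrow> nat \<Rightarrow> complex"
  where A: "\<And>e j. e \<le> n \<Longrightarrow> j \<le> n \<Longrightarrow> (\<Sum>i\<le>n. A e i * of_nat i ^ j) = (if e = j then 1 else 0)"
    using vandermonde_inverse by blast
  show ?thesis
    using poly_coeff_recover[OF A \<open>e \<le> n\<close>, of c] poly_coeff_recover[OF A \<open>e \<le> n\<close>, of d] assms(1) by simp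
qed

text \<open>On the right, \<open>a\<close>, \<open>b\<close> and \<open>c\<close> enter only through
  the values at \<open>y = 0, ..., n\<close>. Polynomials found along progressions of different
  steps therefore have the same coefficients in \<open>y\<close> as soon as they agree at these
  nodes.\<close>

lemma poly_affine_interpolation:
  assumes A: "\<And>e j. e \<le> n \<Longrightarrow> j \<le> n \<Longrightarrow> (\<Sum>i\<le>n. A e i * of_nat i ^ j) = (if e = j then 1 else 0)"
  shows "(\<Sum>j\<le>n. sm ((a * y + b) ^ j) (c j)) =
    (\<Sum>e\<le>n. sm (y ^ e) (\<Sum>i\<le>n. sm (A e i) (\<Sum>j\<le>n. sm ((a * of_nat i + b) ^ j) (c j))))"
proof -
  have 1: "(\<Sum>i\<le>n. sm (A e i) (\<Sum>j\<le>n. sm ((a * of_nat i + b) ^ j) (c j))) =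
      (\<Sum>j\<le>n. sm (\<Sum>i\<le>n. A e i * (a * of_nat i + b) ^ j) (c j))" for e
    unfolding scale_sum_right scale_sum_left scale_scale by (rule sum.swap)
  have "(\<Sum>e\<le>n. sm (y ^ e) (\<Sum>j\<le>n. sm (\<Sum>i\<le>n. A e i * (a * of_nat i + b) ^ j) (c j))) =
     (\<Sum>j\<le>n. sm (\<Sum>e\<le>n. y ^ e * (\<Sum>i\<le>n. A e i * (a * of_nat i + b) ^ j)) (c j))"
    unfolding scale_sum_right[of "y ^ _"] scale_sum_left[of "\<lambda>e. y ^ e * _ e"] scale_scale by (rule sum.swap)
  also have "\<dots> = (\<Sum>j\<le>n. sm ((a * y + b) ^ j) (c j))"
    by (rule sum.cong) (auto simp: affine_power_interpolation[OF A])
  finally show ?thesis unfolding 1 by simp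
qed

text \<open>Dividing by \<open>m ^ n\<close> and letting \<open>m\<close> tend to infinity isolates the leading coefficient,
  whereas it sends a compact set to \<open>0\<close>.\<close>
lemma leading_coeff_eq_0_if_compact:
  assumes C: "compactin TX C"
    and q: "\<And>m. (\<Sum>j\<le>n. sm (of_nat m ^ j) (c j)) \<in> C" and n: "n > 0"
  shows "c n = 0"
proof (rule ccontr)
  assume "c n \<noteq> 0"
  then obtain U V where UV: "openin TX U" "openin TX V" "c n \<in> U" "0 \<in> V" "disjnt U V"
    using Hausdorff_X top_X unfolding Hausdorff_space_def by (metis UNIV_I)
  \<comment> \<open>At \<open>\<epsilon> = 1 / m\<close> this is the polynomial at \<open>m\<close>
    divided by \<open>m ^ n\<close>; at \<open>\<epsilon> = 0\<close> only \<open>c n\<close>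
    survives.\<close>
  define f where "f \<epsilon> = (\<Sum>j\<le>n. sm (\<epsilon> ^ (n - j)) (c j))" for \<epsilon> :: complex
  have "continuous_map euclidean TX f"
    unfolding f_def
    by (intro continuous_map_sum_scale) (auto simp: top_X intro!: continuous_intros)
  then have "open {\<epsilon>. f \<epsilon> \<in> U}"
    using openin_continuous_map_preimage[of euclidean TX f U] UV by simp
  moreover have "f 0 = (\<Sum>j\<le>n. if n = j then c j else 0)"
    unfolding f_def by (rule sum.cong) auto
  then have "f 0 \<in> U" using UV by simp
  ultimately obtain d1 where d1: "d1 > 0" "\<And>\<epsilon>. norm \<epsilon> < d1 \<Longrightarrow> f \<epsilon> \<in> U"
    unfolding open_dist by (auto simp: dist_norm)
  \<comment> \<open>Tube lemma: a single neighbourhood \<open>W\<close> of the scalar 0 scales all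
    of \<open>C\<close> into \<open>V\<close>.\<close>
  have "openin (prod_topology euclidean TX) {z. (\<lambda>(a, x). sm a x) z \<in> V}"
    using openin_continuous_map_preimage[OF cont_scale UV(2)] by (simp add: top_X)
  moreover have "{0} \<times> C \<subseteq> {z. (\<lambda>(a, x). sm a x) z \<in> V}" using UV by auto
  moreover have "compactin (euclidean :: complex topology) {0}" by simp
  ultimately obtain W Y where W: "openin (euclidean :: complex topology) W" "{0} \<subseteq> W" "C \<subseteq> Y"
      "W \<times> Y \<subseteq> {z. (\<lambda>(a, x). sm a x) z \<in> V}"
    using Wallace_theorem_prod_topology[OF _ C] by metis
  then obtain d2 where d2: "d2 > 0" "\<And>\<epsilon>. norm \<epsilon> < d2 \<Longrightarrow> \<epsilon> \<in> W"
    unfolding open_openin[symmetric] open_dist by (auto simp: dist_norm)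
  obtain m :: nat where m: "m > 0" "inverse (real m) < min d1 (min d2 1)"
    using ex_inverse_of_nat_less[of "min d1 (min d2 1)"] d1 d2 by auto
  define \<epsilon> :: complex where "\<epsilon> = inverse (of_nat m)"
  have ne: "norm \<epsilon> < d1" "norm \<epsilon> < d2" "norm \<epsilon> \<le> 1"
    using m by (auto simp: \<epsilon>_def norm_inverse)
  have "norm (\<epsilon> ^ n) \<le> norm \<epsilon>"
    using ne n power_decreasing[of 1 n "norm \<epsilon>"] by (simp add: norm_power)
  then have "\<epsilon> ^ n \<in> W" using ne d2 by auto
  then have "sm (\<epsilon> ^ n) (\<Sum>j\<le>n. sm (of_nat m ^ j) (c j)) \<in> V"
    using subsetD[OF W(4), of "(\<epsilon> ^ n, \<Sum>j\<le>n. sm (of_nat m ^ j) (c j))"] W(3) q[of m] by auto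
  moreover have "sm (\<epsilon> ^ n) (\<Sum>j\<le>n. sm (of_nat m ^ j) (c j)) = f \<epsilon>"
    unfolding f_def scale_sum_right scale_scale
  proof (rule sum.cong, simp)
    fix j assume "j \<in> {..n}"
    then have "\<epsilon> ^ n = \<epsilon> ^ (n - j) * \<epsilon> ^ j" by (simp add: power_add[symmetric])
    then have "\<epsilon> ^ n * of_nat m ^ j = \<epsilon> ^ (n - j)"
      using m by (simp add: \<epsilon>_def power_mult_distrib[symmetric] mult.assoc)
    then show "sm (\<epsilon> ^ n * of_nat m ^ j) (c j) = sm (\<epsilon> ^ (n - j)) (c j)" by simp
  qed
  ultimately show False using d1(2)[OF ne(1)] UV(5) by (auto simp: disjnt_def)
qed

text \<open>Induction on the degree: the leading coefficient vanishes, and what remains still takes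
  its values in \<open>C\<close>.\<close>

lemma compact_valued_poly_constant:
  assumes "compactin TX C" "\<And>m. (\<Sum>j\<le>n. sm (of_nat m ^ j) (c j)) \<in> C"
  shows "(\<Sum>j\<le>n. sm (of_nat m ^ j) (c j)) = c 0"
  using assms(2)
proof (induction n)
  case (Suc n)
  then have "c (Suc n) = 0"
    using leading_coeff_eq_0_if_compact[OF assms(1)] by blast
  with Suc show ?case by simp
qed simp

section \<open>Linear combinations and translates of polynomials\<close>

lemma poly_space_iff:
  "p \<in> poly_space TS TX sm n \<longleftrightarrow> continuous_map TS TX p \<and>
     (\<forall>s t. \<exists>c. \<forall>m. p (s + natmul m t) = (\<Sum>j\<le>n. sm (of_nat m ^ j) (c j)))"
  by (simp add: poly_space_def)

lemma poly_space_sum_scale: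
  assumes "\<And>i. i \<in> I \<Longrightarrow> f i \<in> poly_space TS TX sm n"
  shows "(\<lambda>t. \<Sum>i\<in>I. sm (a i) (f i t)) \<in> poly_space TS TX sm n"
  unfolding poly_space_iff
proof (intro conjI allI)
  show "continuous_map TS TX (\<lambda>t. \<Sum>i\<in>I. sm (a i) (f i t))"
    using assms by (intro continuous_map_sum_scale) (auto simp: poly_space_def)
  fix s t
  have "\<forall>i\<in>I. \<exists>c. \<forall>m. f i (s + natmul m t) = (\<Sum>j\<le>n. sm (of_nat m ^ j) (c j))"
    using assms by (auto simp: poly_space_def)
  then obtain c where c: "\<And>i m. i \<in> I \<Longrightarrow> f i (s + natmul m t) = (\<Sum>j\<le>n. sm (of_nat m ^ j) (c i j))"
    by metis
  have "(\<Sum>i\<in>I. sm (a i) (f i (s + natmul m t))) =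
      (\<Sum>j\<le>n. sm (of_nat m ^ j) (\<Sum>i\<in>I. sm (a i) (c i j)))" for m
  proof -
    have "(\<Sum>i\<in>I. sm (a i) (f i (s + natmul m t))) = (\<Sum>i\<in>I. \<Sum>j\<le>n. sm (of_nat m ^ j) (sm (a i) (c i j)))"
      by (rule sum.cong) (auto simp: c scale_sum_right mult.commute)
    also have "\<dots> = (\<Sum>j\<le>n. sm (of_nat m ^ j) (\<Sum>i\<in>I. sm (a i) (c i j)))"
      unfolding scale_sum_right by (rule sum.swap)
    finally show ?thesis .
  qed
  then show "\<exists>c. \<forall>m. (\<Sum>i\<in>I. sm (a i) (f i (s + natmul m t))) = (\<Sum>j\<le>n. sm (of_nat m ^ j) (c j))"
    by (intro exI[of _ "\<lambda>j. \<Sum>i\<in>I. sm (a i) (c i j)"]) simp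
qed

end

lemma continuous_map_translation:
  assumes "ab_top_group T"
  shows "continuous_map T T (\<lambda>x. x + a)"
proof -
  have "continuous_map T (prod_topology T T) (\<lambda>x. (x, a))"
    using assms by (intro continuous_map_pairedI) (auto simp: ab_top_group_def)
  from continuous_map_compose[OF this, of T "\<lambda>(x, y). x + y"] assms
  show ?thesis by (simp add: o_def ab_top_group_def)
qed

lemma poly_space_translate:
  assumes "ab_top_group TS" "p \<in> poly_space TS TX sm n"
  shows "(\<lambda>t. p (t + a)) \<in> poly_space TS TX sm n"
  unfolding poly_space_def mem_Collect_eq
proof (intro conjI allI)
  show "continuous_map TS TX (\<lambda>t. p (t + a))"
    using continuous_map_compose[OF continuous_map_translation[OF assms(1)]] assms(2)
    by (auto simp: o_def poly_space_def)
  show "\<exists>c. \<forall>m. p (s + natmul m t + a) = (\<Sum>j\<le>n. sm (of_nat m ^ j) (c j))" for s t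
    using assms(2) by (auto simp: poly_space_def ac_simps dest: spec[of _ "a + s"])
qed

section \<open>Expansion along one line; invariance under elements with a multiple in a compact
  set\<close>

context complex_tvs
begin

text \<open>\<open>w e\<close> combines the translates \<open>p (t + \<theta> i)\<close>,
  \<open>i \<le> n\<close>, with the weights \<open>A e i\<close>. It is therefore again a
  polynomial of degree at most \<open>n\<close>, which allows the expansion to be iterated over
  several lines.\<close>

lemma poly_expansion_direction:
  fixes \<theta> :: "real \<Rightarrow> 'g::ab_group_add"
  assumes TG: "ab_top_group TG" and p: "p \<in> poly_space TG TX sm n"
    and S: "S = \<int> \<or> S = UNIV"
    and \<theta>_add: "\<And>x y. x \<in> S \<Longrightarrow> y \<in> S \<Longrightarrow> \<theta> (x + y) = \<theta> x + \<theta> y"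
    and \<theta>_cont: "continuous_map (top_of_set S) TG \<theta>"
  shows "\<exists>w. (\<forall>e\<le>n. w e \<in> poly_space TG TX sm n) \<and>
    (\<forall>t. \<forall>s\<in>S. p (t + \<theta> s) = (\<Sum>e\<le>n. sm (of_real s ^ e) (w e t)))"
proof -
  obtain A :: "nat \<Rightarrow> nat \<Rightarrow> complex"
  where A: "\<And>e j. e \<le> n \<Longrightarrow> j \<le> n \<Longrightarrow> (\<Sum>i\<le>n. A e i * of_nat i ^ j) = (if e = j then 1 else 0)"
    using vandermonde_inverse by blast
  define w where "w e t = (\<Sum>i\<le>n. sm (A e i) (p (t + \<theta> (real i))))" for e t
  have w: "w e \<in> poly_space TG TX sm n" for e
    unfolding w_def by (intro poly_space_sum_scale poly_space_translate[OF TG p])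
  have S_ring: "x + y \<in> S" "of_int z \<in> S" "real i \<in> S" if "x \<in> S" "y \<in> S" for x y z i
    using S that by auto
  \<comment> \<open>\<open>s\<close> lies on a progression of step \<open>1 / b\<close> inside
    \<open>S\<close>: \<open>b = 1\<close> serves the integers, arbitrary \<open>b\<close> the
    rationals.\<close>
  have rational: "p (t + \<theta> s) = (\<Sum>e\<le>n. sm (of_real s ^ e) (w e t))"
    if b: "b > 0" "1 / real b \<in> S" and s: "s = of_int a / real b" for a b s t
  proof -
    \<comment> \<open>Polynomiality is known only for nonnegative multiples, so the progression
      starts at \<open>- M\<close>. With \<open>M = |a|\<close>, step \<open>a + b * M\<close> is
      nonnegative and reaches \<open>s\<close>, while step \<open>b * i + b * M\<close> reaches the
      node \<open>i\<close>.\<close>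
    define M where "M = nat \<bar>a\<bar>"
    have S_mult: "real m / real b \<in> S \<and> \<theta> (real m / real b) = natmul m (\<theta> (1 / real b))" for m
    proof (induction m)
      case 0
      have "0 \<in> S" using S by auto
      from \<theta>_add[OF this this] this show ?case by simp
    next
      case (Suc m)
      have eq: "real (Suc m) / real b = 1 / real b + real m / real b" by (simp add: add_divide_distrib)
      show ?case unfolding eq using Suc b S_ring \<theta>_add by simp
    qed
    have M_S: "- real M \<in> S" using S by auto
    obtain c where c: "\<And>m. p (t + \<theta> (- real M) + natmul m (\<theta> (1 / real b))) = (\<Sum>j\<le>n. sm (of_nat m ^ j) (c j))"
      using p unfolding poly_space_iff by metis
    have val: "p (t + \<theta> (real m / real b - real M)) = (\<Sum>j\<le>n. sm (of_nat m ^ j) (c j))" for m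
      using c[of m] \<theta>_add[OF M_S, of "real m / real b"] S_mult[of m] by (simp add: add.assoc)
    have bM: "a + int b * int M \<ge> 0"
    proof -
      have "int M \<le> int b * int M" using b by (cases b) (auto simp: algebra_simps)
      then show ?thesis by (simp add: M_def)
    qed
    have node: "p (t + \<theta> (real i)) = (\<Sum>j\<le>n. sm ((of_nat b * of_nat i + of_nat b * of_nat M) ^ j) (c j))" for i
    proof -
      have "real (b * i + b * M) / real b - real M = real i" using b by (simp add: field_simps)
      with val[of "b * i + b * M"] show ?thesis by simp
    qed
    have "real (nat (a + int b * int M)) / real b - real M = s"
      using bM b by (simp add: s field_simps)
    moreover have "(of_nat (nat (a + int b * int M)) :: complex) = of_nat b * of_real s + of_nat b * of_nat M"
      using bM b by (simp add: s)
    ultimately have "p (t + \<theta> s) = (\<Sum>j\<le>n. sm ((of_nat b * of_real s + of_nat b * of_nat M) ^ j) (c j))"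
      using val[of "nat (a + int b * int M)"] by simp
    also have "\<dots> = (\<Sum>e\<le>n. sm (of_real s ^ e) (w e t))"
      unfolding w_def node by (rule poly_affine_interpolation[OF A])
    finally show ?thesis .
  qed
  have "p (t + \<theta> s) = (\<Sum>e\<le>n. sm (of_real s ^ e) (w e t))" if "s \<in> S" for s t
  proof (cases "S = UNIV")
    case False
    then have "s \<in> \<int>" using that S by blast
    then obtain z where "s = of_int z" by (elim Ints_cases)
    moreover have "1 / real 1 \<in> S" using S by auto
    ultimately show ?thesis by (intro rational[of 1 s z t]) simp_all
  next
    case True
    have f: "continuous_map euclidean TX (\<lambda>s. p (t + \<theta> s))"
    proof -
      have "continuous_map euclidean TG (\<lambda>s. \<theta> s + t)"
        using continuous_map_compose[OF \<theta>_cont continuous_map_translation[OF TG, of t]] True by (simp add: o_def)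
      from continuous_map_compose[OF this, of TX p] p show ?thesis
        by (simp add: o_def add.commute poly_space_def)
    qed
    have g: "continuous_map euclidean TX (\<lambda>s. \<Sum>e\<le>n. sm (of_real s ^ e) (w e t))"
      by (intro continuous_map_sum_scale) (auto simp: top_X intro!: continuous_intros)
    \<comment> \<open>Both sides are continuous in \<open>s\<close> with values in a Hausdorff space
      and agree on the dense set of rationals.\<close>
    have "s \<in> euclidean closure_of \<rat>"
      using Rats_closure_real by (simp add: euclidean_closure_of)
    then show ?thesis
    proof (rule forall_in_closure_of_eq[OF _ Hausdorff_X f g])
      fix x :: real assume "x \<in> \<rat>"
      then obtain a b' where "b' > 0" "x = of_int a / of_int b'"
        by (elim Rats_cases')
      then obtain b where "b > 0" "x = of_int a / real b"
        by (metis of_int_of_nat_eq pos_int_cases of_nat_0_less_iff)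
      then show "p (t + \<theta> x) = (\<Sum>e\<le>n. sm (of_real x ^ e) (w e t))"
        using rational True by blast
    qed
  qed
  with w show ?thesis by blast
qed

text \<open>The multiples of \<open>natmul N u\<close> stay in \<open>K\<close>, so along them
  \<open>p\<close> takes values in a compact set and is constant. They are every \<open>N\<close>-th
  point of the progression \<open>s + m u\<close>, and a polynomial constant on those points is
  constant.\<close>

lemma poly_invariant_modulo_torsion_compact:
  assumes TG: "ab_top_group TG" and p: "p \<in> poly_space TG TX sm n"
    and K: "compactin TG K" "\<And>i. natmul i (natmul N u) \<in> K" and N: "N > 0"
  shows "p (s + u) = p s"
proof -
  obtain c where c: "\<And>m. p (s + natmul m u) = (\<Sum>j\<le>n. sm (of_nat m ^ j) (c j))"
    using p unfolding poly_space_iff by metis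
  obtain d where d: "\<And>m. p (s + natmul m (natmul N u)) = (\<Sum>j\<le>n. sm (of_nat m ^ j) (d j))"
    using p unfolding poly_space_iff by metis
  have "compactin TX ((\<lambda>x. p (x + s)) ` K)"
    using poly_space_translate[OF TG p] K(1) by (auto simp: poly_space_def intro: image_compactin)
  moreover have "(\<Sum>j\<le>n. sm (of_nat m ^ j) (d j)) \<in> (\<lambda>x. p (x + s)) ` K" for m
    using K(2)[of m] d[of m] by (intro image_eqI[of _ _ "natmul m (natmul N u)"]) (simp_all add: add.commute)
  ultimately have const: "p (s + natmul m (natmul N u)) = d 0" for m
    unfolding d by (rule compact_valued_poly_constant)
  \<comment> \<open>Both sides equal \<open>p\<close> at \<open>s + m N u\<close>; comparing
    coefficients makes every \<open>c j\<close> with \<open>0 < j \<le> n\<close> vanish.\<close>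
  have "(\<Sum>j\<le>n. sm (of_nat m ^ j) (sm (of_nat N ^ j) (c j))) =
      (\<Sum>j\<le>n. sm (of_nat m ^ j) (if j = 0 then d 0 else 0))" for m
  proof -
    have "(\<Sum>j\<le>n. sm (of_nat m ^ j) (sm (of_nat N ^ j) (c j))) = p (s + natmul (m * N) u)"
      unfolding c by (simp add: power_mult_distrib)
    also have "\<dots> = (\<Sum>j\<le>n. if j = 0 then d 0 else 0)"
      using const[of m] by (simp add: natmul_mult)
    also have "\<dots> = (\<Sum>j\<le>n. sm (of_nat m ^ j) (if j = 0 then d 0 else 0))"
      by (rule sum.cong) auto
    finally show ?thesis .
  qed
  then have "sm (of_nat N ^ j) (c j) = (if j = 0 then d 0 else 0)" if "j \<le> n" for j
    using that by (rule poly_coeff_unique)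
  then have c0: "c j = (if j = 0 then d 0 else 0)" if "j \<le> n" for j
    using that N by (metis power_0 scale_one power_not_zero of_nat_eq_0_iff scale_eq_0_iff less_irrefl)
  have "p (s + natmul m u) = (\<Sum>j\<le>n. if j = 0 then d 0 else 0)" for m
    unfolding c by (rule sum.cong) (auto simp: c0)
  then have "p (s + natmul 1 u) = p (s + natmul 0 u)" by metis
  then show ?thesis by simp
qed

end

section \<open>Coordinates on the group and their monomials\<close>

text \<open>Multi-indices, as lists to which the exponent of a further line can be appended. Each
  entry is bounded rather than their sum, since the expansion treats one line at a time.\<close>

definition exponents :: "nat \<Rightarrow> nat \<Rightarrow> nat list set" where
  "exponents n d = {b. set b \<subseteq> {..n} \<and> length b = d}"

lemma finite_exponents: "finite (exponents n d)"
  unfolding exponents_def by (rule finite_lists_length_eq) simp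

lemma exponents_Suc: "exponents n (Suc d) = (\<lambda>(b, e). b @ [e]) ` (exponents n d \<times> {..n})"
  by (auto simp: exponents_def length_Suc_conv_rev image_iff)

text \<open>Up to elements with a multiple in the compact set \<open>K\<close>, the group is a product of \<open>D\<close>
  lines \<open>\<theta> i\<close> over \<open>S i\<close>, each a copy of the integers or of the reals, with coordinates \<open>\<pi> i\<close>.\<close>
locale group_coordinates =
  fixes TG :: "'g::ab_group_add topology" and D :: nat and S :: "nat \<Rightarrow> real set"
    and \<theta> :: "nat \<Rightarrow> real \<Rightarrow> 'g" and \<pi> :: "nat \<Rightarrow> 'g \<Rightarrow> real" and K :: "'g set"
  assumes TG: "ab_top_group TG"
    and S: "\<And>i. i < D \<Longrightarrow> S i = \<int> \<or> S i = UNIV"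
    and \<theta>_add: "\<And>i x y. i < D \<Longrightarrow> x \<in> S i \<Longrightarrow> y \<in> S i \<Longrightarrow> \<theta> i (x + y) = \<theta> i x + \<theta> i y"
    and \<theta>_cont: "\<And>i. i < D \<Longrightarrow> continuous_map (top_of_set (S i)) TG (\<theta> i)"
    and \<pi>_add: "\<And>i. i < D \<Longrightarrow> Modules.additive (\<pi> i)"
    and \<pi>_cont: "\<And>i. i < D \<Longrightarrow> continuous_map TG euclidean (\<pi> i)"
    and \<pi>_range: "\<And>i g. i < D \<Longrightarrow> \<pi> i g \<in> S i"
    and K: "compactin TG K"
    and K_natmul: "\<And>x i. x \<in> K \<Longrightarrow> natmul i x \<in> K"
    and torsion: "\<And>g. \<exists>N>0. natmul N (g - (\<Sum>i<D. \<theta> i (\<pi> i g))) \<in> K"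
begin

definition coord_monomial :: "nat list \<Rightarrow> 'g \<Rightarrow> complex" where
  "coord_monomial b h = (\<Prod>i<D. of_real (\<pi> i h) ^ (b ! i))"

text \<open>Additivity of the coordinates makes a monomial homogeneous of its total degree, so that
  terms can be sorted by powers of \<open>m\<close>.\<close>

lemma coord_monomial_natmul: "coord_monomial b (natmul m h) = of_nat m ^ (\<Sum>i<D. b ! i) * coord_monomial b h"
proof -
  have "coord_monomial b (natmul m h) = (\<Prod>i<D. of_nat m ^ (b ! i) * of_real (\<pi> i h) ^ (b ! i))"
    unfolding coord_monomial_def
    by (rule prod.cong) (auto simp: additive.natmul[OF \<pi>_add] power_mult_distrib)
  then show ?thesis by (simp add: coord_monomial_def prod.distrib power_sum)
qed

lemma coord_monomial_0: "coord_monomial b 0 = (if (\<Sum>i<D. b ! i) = 0 then 1 else 0)"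
proof (cases "(\<Sum>i<D. b ! i) = 0")
  case True
  then show ?thesis by (simp add: coord_monomial_def)
next
  case False
  \<comment> \<open>Homogeneity is applied with the multiple \<open>m = 0\<close>.\<close>
  then have "(of_nat 0 :: complex) ^ (\<Sum>i<D. b ! i) = 0" by (simp add: power_0_left del: sum_eq_0_iff)
  with coord_monomial_natmul[of b 0 0] False show ?thesis by (simp only: mult_zero_left natmul_0 if_False)
qed

text \<open>Along \<open>s + m t\<close> every coordinate is affine in \<open>m\<close>, so the
  monomial becomes a product of powers of polynomials of degree at most 1.\<close>

lemma coord_monomial_poly_space:
  assumes "(\<Sum>i<D. b ! i) \<le> n"
  shows "coord_monomial b \<in> scalar_poly_space TG n"
  unfolding poly_space_def mem_Collect_eq
proof (intro conjI allI)
  have "continuous_map TG euclidean (\<lambda>h. \<Prod>i\<in>I. (of_real (\<pi> i h) :: complex) ^ (b ! i))" if "I \<subseteq> {..<D}" for I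
    using that
  proof (induction I rule: infinite_finite_induct)
    case (insert i I)
    have "continuous_map TG euclidean (\<lambda>h. of_real (\<pi> i h) ^ (b ! i) :: complex)"
    proof -
      have "continuous_map euclidean euclidean (\<lambda>x :: real. of_real x ^ (b ! i) :: complex)"
        by (auto intro!: continuous_intros)
      with continuous_map_compose[OF \<pi>_cont this] insert show ?thesis by (simp add: o_def)
    qed
    then show ?case using insert by (simp add: continuous_map_times_complex)
  qed auto
  from this[of "{..<D}"] show "continuous_map TG euclidean (coord_monomial b)"
    by (simp add: coord_monomial_def[abs_def])
  fix s t
  define P :: "complex poly" where "P = (\<Prod>i<D. [:of_real (\<pi> i s), of_real (\<pi> i t):] ^ (b ! i))"
  have "degree P \<le> (\<Sum>i<D. degree ([:of_real (\<pi> i s) :: complex, of_real (\<pi> i t):] ^ (b ! i)))"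
    unfolding P_def using degree_prod_sum_le[of "{..<D}"
      "\<lambda>i. [:of_real (\<pi> i s) :: complex, of_real (\<pi> i t):] ^ (b ! i)"] by (simp add: o_def)
  also have "\<dots> \<le> (\<Sum>i<D. b ! i)"
  proof (rule sum_mono)
    show "degree ([:of_real (\<pi> i s) :: complex, of_real (\<pi> i t):] ^ (b ! i)) \<le> b ! i" for i
      using degree_power_le[of "[:of_real (\<pi> i s) :: complex, of_real (\<pi> i t):]" "b ! i"]
      by (auto split: if_splits)
  qed
  finally have deg: "degree P \<le> n" using assms by simp
  have "coord_monomial b (s + natmul m t) = poly P (of_nat m)" for m
    unfolding coord_monomial_def P_def poly_prod
    by (rule prod.cong) (auto simp: additive.natmul[OF \<pi>_add] additive.add[OF \<pi>_add])
  then show "\<exists>c. \<forall>m. coord_monomial b (s + natmul m t) = (\<Sum>j\<le>n. of_nat m ^ j * c j)"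
    using poly_eq_sum_coeff_atMost[OF deg] by (intro exI[of _ "poly.coeff P"]) (simp add: mult.commute)
qed

end

section \<open>Expansion of polynomials in all coordinates\<close>

locale tvs_group_coordinates = complex_tvs TX sm + group_coordinates TG D S \<theta> \<pi> K
  for TX :: "'x::ab_group_add topology" and sm
    and TG :: "'g::ab_group_add topology" and D S \<theta> \<pi> K
begin

text \<open>Induction on the number of lines: the coefficient functions obtained so far are
  themselves polynomials on the group, so each can be expanded along the next line.\<close>

lemma poly_expansion_lines:
  assumes "p \<in> poly_space TG TX sm n" "d \<le> D"
  shows "\<exists>x. (\<forall>b\<in>exponents n d. x b \<in> poly_space TG TX sm n) \<and>
    (\<forall>t y. (\<forall>i<d. y i \<in> S i) \<longrightarrow>
      p (t + (\<Sum>i<d. \<theta> i (y i))) = (\<Sum>b\<in>exponents n d. sm (\<Prod>i<d. of_real (y i) ^ (b ! i)) (x b t)))"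
  using assms(2)
proof (induction d)
  case 0
  have "exponents n 0 = {[]}" by (auto simp: exponents_def)
  then show ?case using assms(1) by (intro exI[of _ "\<lambda>_. p"]) simp
next
  case (Suc d)
  then have "d \<le> D" "d < D" by simp_all
  from Suc.IH[OF this(1)] obtain x where x: "\<And>b. b \<in> exponents n d \<Longrightarrow> x b \<in> poly_space TG TX sm n"
    and px: "\<And>t y. (\<forall>i<d. y i \<in> S i) \<Longrightarrow>
      p (t + (\<Sum>i<d. \<theta> i (y i))) = (\<Sum>b\<in>exponents n d. sm (\<Prod>i<d. of_real (y i) ^ (b ! i)) (x b t))"
    by blast
  have "\<forall>b\<in>exponents n d. \<exists>w. (\<forall>e\<le>n. w e \<in> poly_space TG TX sm n) \<and>
    (\<forall>t. \<forall>s\<in>S d. x b (t + \<theta> d s) = (\<Sum>e\<le>n. sm (of_real s ^ e) (w e t)))"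
    using poly_expansion_direction[OF TG x S[OF \<open>d < D\<close>] \<theta>_add[OF \<open>d < D\<close>] \<theta>_cont[OF \<open>d < D\<close>]] by blast
  from bchoice[OF this] obtain w where w: "\<And>b e. b \<in> exponents n d \<Longrightarrow> e \<le> n \<Longrightarrow> w b e \<in> poly_space TG TX sm n"
    and xw: "\<And>b t s. b \<in> exponents n d \<Longrightarrow> s \<in> S d \<Longrightarrow> x b (t + \<theta> d s) = (\<Sum>e\<le>n. sm (of_real s ^ e) (w b e t))"
    by blast
  \<comment> \<open>A multi-index for \<open>Suc d\<close> lines is \<open>b @ [e]\<close>; its
    coefficient is the \<open>e\<close>-th one in the expansion of \<open>x b\<close> along line
    \<open>d\<close>.\<close>
  define x' where "x' b = w (butlast b) (last b)" for b
  show ?case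
  proof (intro exI[of _ x'] conjI allI impI ballI)
    fix b assume "b \<in> exponents n (Suc d)"
    then show "x' b \<in> poly_space TG TX sm n"
      unfolding exponents_Suc x'_def using w by auto
  next
    fix t y assume y: "\<forall>i<Suc d. y i \<in> S i"
    \<comment> \<open>The new line is absorbed into the base point before the induction hypothesis
      expands the others.\<close>
    have "p (t + (\<Sum>i<Suc d. \<theta> i (y i))) = p (t + \<theta> d (y d) + (\<Sum>i<d. \<theta> i (y i)))"
      by (simp add: ac_simps)
    also have "\<dots> = (\<Sum>b\<in>exponents n d. sm (\<Prod>i<d. of_real (y i) ^ (b ! i)) (x b (t + \<theta> d (y d))))"
      using y by (intro px) auto
    also have "\<dots> = (\<Sum>b\<in>exponents n d. \<Sum>e\<le>n. sm (\<Prod>i<Suc d. of_real (y i) ^ ((b @ [e]) ! i)) (x' (b @ [e]) t))"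
    proof (rule sum.cong)
      fix b assume b: "b \<in> exponents n d"
      then have "length b = d" by (simp add: exponents_def)
      then have "(\<Prod>i<Suc d. of_real (y i) ^ ((b @ [e]) ! i)) = (\<Prod>i<d. of_real (y i) ^ (b ! i)) * (of_real (y d) ^ e :: complex)" for e
        by (auto simp: nth_append intro!: prod.cong)
      then show "sm (\<Prod>i<d. of_real (y i) ^ (b ! i)) (x b (t + \<theta> d (y d))) =
        (\<Sum>e\<le>n. sm (\<Prod>i<Suc d. of_real (y i) ^ ((b @ [e]) ! i)) (x' (b @ [e]) t))"
        using b y by (simp add: xw scale_sum_right x'_def del: prod.lessThan_Suc)
    qed simp
    also have "\<dots> = (\<Sum>b\<in>exponents n (Suc d). sm (\<Prod>i<Suc d. of_real (y i) ^ (b ! i)) (x' b t))"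
      unfolding exponents_Suc sum.cartesian_product
      by (subst sum.reindex) (auto intro!: inj_onI sum.cong)
    finally show "p (t + (\<Sum>i<Suc d. \<theta> i (y i))) = (\<Sum>b\<in>exponents n (Suc d). sm (\<Prod>i<Suc d. of_real (y i) ^ (b ! i)) (x' b t))" .
  qed
qed

text \<open>\<open>h\<close> differs from \<open>\<Sum>i<D. \<theta> i (\<pi> i h)\<close> by an
  element with a positive multiple in \<open>K\<close>. By invariance \<open>p\<close> does not see
  the difference, so the expansion along the lines applies.\<close>

lemma poly_expansion:
  assumes p: "p \<in> poly_space TG TX sm n"
  shows "\<exists>x. (\<forall>b\<in>exponents n D. x b \<in> poly_space TG TX sm n) \<and>
    (\<forall>t h. p (t + h) = (\<Sum>b\<in>exponents n D. sm (coord_monomial b h) (x b t)))"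
proof -
  obtain x where x: "\<forall>b\<in>exponents n D. x b \<in> poly_space TG TX sm n"
    and px: "\<And>t y. (\<forall>i<D. y i \<in> S i) \<Longrightarrow>
      p (t + (\<Sum>i<D. \<theta> i (y i))) = (\<Sum>b\<in>exponents n D. sm (\<Prod>i<D. of_real (y i) ^ (b ! i)) (x b t))"
    using poly_expansion_lines[OF p order_refl] by blast
  have "p (t + h) = (\<Sum>b\<in>exponents n D. sm (coord_monomial b h) (x b t))" for t h
  proof -
    define u where "u = h - (\<Sum>i<D. \<theta> i (\<pi> i h))"
    obtain N where N: "N > 0" "natmul N u \<in> K" using torsion[of h] u_def by auto
    have "p (t + h) = p (t + (\<Sum>i<D. \<theta> i (\<pi> i h)) + u)" by (simp add: u_def)
    also have "\<dots> = p (t + (\<Sum>i<D. \<theta> i (\<pi> i h)))"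
      using poly_invariant_modulo_torsion_compact[OF TG p K] K_natmul N by blast
    also have "\<dots> = (\<Sum>b\<in>exponents n D. sm (coord_monomial b h) (x b t))"
      unfolding coord_monomial_def using px \<pi>_range by simp
    finally show ?thesis .
  qed
  with x show ?thesis by blast
qed

text \<open>The monomials of degree above \<open>n\<close> cancel: compare the powers of \<open>m\<close> in \<open>p (t + m h)\<close>.\<close>
lemma poly_difference_expansion:
  assumes p: "p \<in> poly_space TG TX sm n"
  shows "\<exists>x. (\<forall>b\<in>exponents n D. x b \<in> poly_space TG TX sm n) \<and>
    (\<forall>t h. p (t + h) - p t =
      (\<Sum>b | b \<in> exponents n D \<and> 0 < (\<Sum>i<D. b ! i) \<and> (\<Sum>i<D. b ! i) \<le> n. sm (coord_monomial b h) (x b t)))"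
proof -
  obtain x where x: "\<forall>b\<in>exponents n D. x b \<in> poly_space TG TX sm n"
    and px: "\<And>t h. p (t + h) = (\<Sum>b\<in>exponents n D. sm (coord_monomial b h) (x b t))"
    using poly_expansion[OF p] by blast
  define deg where "deg b = (\<Sum>i<D. b ! i)" for b :: "nat list"
  have "p (t + h) - p t = (\<Sum>b | b \<in> exponents n D \<and> 0 < deg b \<and> deg b \<le> n. sm (coord_monomial b h) (x b t))" for t h
  proof -
    \<comment> \<open>\<open>H j\<close> collects the terms that are homogeneous of degree
      \<open>j\<close> in \<open>h\<close>.\<close>
    define H where "H j = (\<Sum>b | b \<in> exponents n D \<and> deg b = j. sm (coord_monomial b h) (x b t))" for j
    \<comment> \<open>\<open>M\<close> bounds \<open>n\<close> and all total degrees, so both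
      descriptions of \<open>p (t + m h)\<close> become polynomials in \<open>m\<close> of the same
      formal length.\<close>
    define M where "M = max n (Max (deg ` exponents n D))"
    have M: "deg b \<le> M" if "b \<in> exponents n D" for b
      using that finite_exponents[of n D] by (auto simp: M_def le_max_iff_disj)
    have expand: "p (t + natmul m h) = (\<Sum>j\<le>M. sm (of_nat m ^ j) (H j))" for m
    proof -
      have "p (t + natmul m h) = (\<Sum>b\<in>exponents n D. sm (of_nat m ^ deg b) (sm (coord_monomial b h) (x b t)))"
        unfolding px coord_monomial_natmul deg_def by simp
      also have "\<dots> = (\<Sum>j\<le>M. \<Sum>b | b \<in> exponents n D \<and> deg b = j. sm (of_nat m ^ deg b) (sm (coord_monomial b h) (x b t)))"
        by (rule sum.group[symmetric]) (use finite_exponents M in auto)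
      also have "\<dots> = (\<Sum>j\<le>M. sm (of_nat m ^ j) (H j))"
        unfolding H_def scale_sum_right by (intro sum.cong) auto
      finally show ?thesis .
    qed
    obtain c where c: "\<And>m. p (t + natmul m h) = (\<Sum>j\<le>n. sm (of_nat m ^ j) (c j))"
      using p unfolding poly_space_iff by metis
    \<comment> \<open>Padding with zeros above \<open>n\<close> makes the comparison yield
      \<open>H j = 0\<close> for \<open>n < j \<le> M\<close>.\<close>
    define c' where "c' j = (if j \<le> n then c j else 0)" for j
    have "p (t + natmul m h) = (\<Sum>j\<le>M. sm (of_nat m ^ j) (c' j))" for m
      unfolding c by (rule sum.mono_neutral_cong_left) (auto simp: c'_def M_def)
    then have H: "H j = c' j" if "j \<le> M" for j
      using poly_coeff_unique[where n = M and c = H and d = c' and e = j] expand that by simp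
    \<comment> \<open>The value at \<open>m = 0\<close>; afterwards \<open>m = 1\<close> gives
      \<open>p (t + h)\<close>.\<close>
    have "H 0 = p t"
    proof -
      have "(\<Sum>j\<le>M. sm (of_nat 0 ^ j) (H j)) = (\<Sum>j\<le>M. if j = 0 then H j else 0)"
        by (rule sum.cong) auto
      then show ?thesis using expand[of 0] by simp
    qed
    have "p (t + h) = (\<Sum>j\<le>M. H j)" using expand[of 1] by simp
    also have "\<dots> = (\<Sum>j\<le>n. H j)"
      by (rule sum.mono_neutral_right) (auto simp: H c'_def M_def)
    also have "\<dots> = p t + (\<Sum>j\<in>{0<..n}. H j)"
    proof -
      have "{..n} = insert 0 {0<..n}" by auto
      then show ?thesis using \<open>H 0 = p t\<close> by simp
    qed
    also have "(\<Sum>j\<in>{0<..n}. H j) = (\<Sum>b | b \<in> exponents n D \<and> 0 < deg b \<and> deg b \<le> n. sm (coord_monomial b h) (x b t))"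
    proof -
      let ?B = "{b. b \<in> exponents n D \<and> 0 < deg b \<and> deg b \<le> n}"
      have "finite ?B" using finite_exponents[of n D] by (rule rev_finite_subset) auto
      have "(\<Sum>b\<in>?B. sm (coord_monomial b h) (x b t)) =
          (\<Sum>j\<in>{0<..n}. \<Sum>b | b \<in> ?B \<and> deg b = j. sm (coord_monomial b h) (x b t))"
        by (rule sum.group[symmetric]) (use \<open>finite ?B\<close> in auto)
      also have "\<dots> = (\<Sum>j\<in>{0<..n}. H j)"
        unfolding H_def by (intro sum.cong) auto
      finally show ?thesis by simp
    qed
    finally show ?thesis by simp
  qed
  with x show ?thesis unfolding deg_def by blast
qed

end

section \<open>The additive group as an algebraic structure; integer multiples\<close>

lemma add_grp_simps [simp]:
  "carrier add_grp = UNIV" "x \<otimes>\<^bsub>add_grp\<^esub> y = x + y" "\<one>\<^bsub>add_grp\<^esub> = 0"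
  by (simp_all add: add_grp_def)

lemma comm_group_add_grp: "comm_group (add_grp :: 'a::ab_group_add monoid)"
proof (rule comm_groupI)
  show "\<exists>y\<in>carrier add_grp. y \<otimes>\<^bsub>add_grp\<^esub> x = \<one>\<^bsub>add_grp\<^esub>" for x :: 'a
    by (auto intro: exI[of _ "- x"])
qed (auto simp: ac_simps)

lemma inv_add_grp [simp]: "inv\<^bsub>add_grp\<^esub> x = - x"
  using group.inv_equality[OF comm_group.axioms(2)[OF comm_group_add_grp], of "- x" x] by simp

lemma nat_pow_add_grp: "x [^]\<^bsub>add_grp\<^esub> (i :: nat) = natmul i x"
  by (induction i) (simp_all add: add.commute)

lemma natmul_int [simp]: "natmul i (x :: int) = int i * x"
  by (simp add: natmul_def)

definition intmul :: "int \<Rightarrow> 'a::ab_group_add \<Rightarrow> 'a" where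
  "intmul a t = natmul (nat a) t - natmul (nat (- a)) t"

text \<open>Any representation of an integer as a difference of naturals may be used, which reduces
  additivity of \<open>intmul\<close> to that of \<open>natmul\<close>.\<close>

lemma intmul_diff_int: "intmul (int i - int j) t = natmul i t - natmul j t"
proof (cases "j \<le> i")
  case True
  then show ?thesis using natmul_add[of "i - j" j t] by (simp add: intmul_def nat_diff_distrib)
next
  case False
  then show ?thesis using natmul_add[of "j - i" i t] by (simp add: intmul_def nat_diff_distrib)
qed

lemma intmul_add: "intmul (a + b) t = intmul a t + intmul b t"
proof -
  obtain i j i' j' where "a = int i - int j" "b = int i' - int j'"
    by (metis int_diff_cases)
  then have "a + b = int (i + i') - int (j + j')" by simp
  then show ?thesis
    using \<open>a = _\<close> \<open>b = _\<close> by (simp only: intmul_diff_int natmul_add) (simp add: algebra_simps)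
qed

lemma (in additive) intmul: "f (intmul a t) = intmul a (f t)"
  by (simp add: intmul_def diff natmul)

lemma intmul_int [simp]: "intmul a (x :: int) = a * x"
  by (cases "a \<ge> 0") (simp_all add: intmul_def)

section \<open>Real homomorphisms on a subgroup and their extension\<close>

locale subgroup_real_hom =
  fixes H :: "'g::ab_group_add set" and \<rho> :: "'g \<Rightarrow> real"
  assumes H: "subgroup H add_grp"
    and hom_add: "\<And>x y. x \<in> H \<Longrightarrow> y \<in> H \<Longrightarrow> \<rho> (x + y) = \<rho> x + \<rho> y"
begin

lemma zero_mem: "0 \<in> H" and add_mem: "x \<in> H \<Longrightarrow> y \<in> H \<Longrightarrow> x + y \<in> H"
  and minus_mem: "x \<in> H \<Longrightarrow> - x \<in> H"
  using subgroup.one_closed[OF H] subgroup.m_closed[OF H, of x y] subgroup.m_inv_closed[OF H, of x] by simp_all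

lemma hom_zero: "\<rho> 0 = 0"
  using hom_add[OF zero_mem zero_mem] by simp

lemma hom_diff: "x \<in> H \<Longrightarrow> y \<in> H \<Longrightarrow> x - y \<in> H \<and> \<rho> (x - y) = \<rho> x - \<rho> y"
  using hom_add[of "x - y" y] add_mem[of x "- y"] minus_mem[of y] by simp

lemma hom_natmul: "x \<in> H \<Longrightarrow> natmul i x \<in> H \<and> \<rho> (natmul i x) = real i * \<rho> x"
  by (induction i) (auto simp: zero_mem hom_zero add_mem hom_add algebra_simps)

lemma hom_sum:
  assumes "\<And>i. i \<in> I \<Longrightarrow> f i \<in> H"
  shows "sum f I \<in> H \<and> \<rho> (sum f I) = (\<Sum>i\<in>I. \<rho> (f i))"
  using assms
  by (induction I rule: infinite_finite_induct) (auto simp: zero_mem hom_zero add_mem hom_add)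

text \<open>Divide by \<open>N\<close> what \<open>\<rho>\<close> gives on the \<open>N\<close>-fold multiple.\<close>
lemma torsion_extension:
  fixes u :: "'a::ab_group_add \<Rightarrow> 'g"
  assumes u: "Modules.additive u" and tor: "\<And>g. \<exists>N>0. natmul N (u g) \<in> H"
  obtains r where "Modules.additive r"
    "\<And>g N. N > 0 \<Longrightarrow> natmul N (u g) \<in> H \<Longrightarrow> r g = \<rho> (natmul N (u g)) / real N"
proof -
  obtain N where N: "\<And>g. N g > 0" "\<And>g. natmul (N g) (u g) \<in> H" using tor by metis
  define r where "r g = \<rho> (natmul (N g) (u g)) / real (N g)" for g
  \<comment> \<open>The quotient is independent of the multiple: both candidates are compared
    through \<open>\<rho>\<close> at the product of the two multipliers.\<close>
  have r: "r g = \<rho> (natmul M (u g)) / real M" if "M > 0" "natmul M (u g) \<in> H" for g M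
  proof -
    have "real M * \<rho> (natmul (N g) (u g)) = real (N g) * \<rho> (natmul M (u g))"
      using hom_natmul[OF N(2)[of g], of M] hom_natmul[OF that(2), of "N g"]
      by (simp add: natmul_mult[symmetric] mult.commute)
    then show ?thesis using N(1)[of g] that(1) by (simp add: r_def field_simps)
  qed
  have "Modules.additive r"
  proof
    fix x y
    \<comment> \<open>A common multiple brings both \<open>u x\<close> and \<open>u y\<close> into
      \<open>H\<close>.\<close>
    define M where "M = N x * N y"
    have M: "M > 0" using N by (simp add: M_def)
    have xy: "natmul M (u x) \<in> H" "natmul M (u y) \<in> H"
      using hom_natmul[OF N(2)[of x], of "N y"] hom_natmul[OF N(2)[of y], of "N x"]
      by (simp_all add: M_def natmul_mult[symmetric] mult.commute)
    have eq: "natmul M (u (x + y)) = natmul M (u x) + natmul M (u y)"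
      by (simp add: additive.add[OF u] natmul_add_right)
    show "r (x + y) = r x + r y"
      using r[OF M xy(1)] r[OF M xy(2)] r[OF M, of "x + y"] add_mem[OF xy] hom_add[OF xy]
      by (simp add: eq add_divide_distrib)
  qed
  with r that show ?thesis by blast
qed

end

text \<open>Translation carries a neighbourhood of \<open>x0\<close> to one of 0, where continuity
  on the open set \<open>H\<close> applies; additivity turns the translation into adding the
  constant \<open>f x0\<close>.\<close>

lemma continuous_map_additive_open_subgroup:
  fixes f :: "'g::ab_group_add \<Rightarrow> real"
  assumes TG: "ab_top_group TG" and H: "openin TG H" "0 \<in> H"
    and f: "Modules.additive f" and cont: "continuous_map (subtopology TG H) euclidean f"
  shows "continuous_map TG euclidean f"
  unfolding continuous_map_def
proof (intro conjI allI impI)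
  have top: "topspace TG = UNIV" using TG by (simp add: ab_top_group_def)
  fix U :: "real set" assume U: "openin euclidean U"
  show "openin TG {x \<in> topspace TG. f x \<in> U}"
    unfolding openin_subopen[of TG "{x \<in> topspace TG. f x \<in> U}"]
  proof
    fix x0 assume x0: "x0 \<in> {x \<in> topspace TG. f x \<in> U}"
    define V where "V = {y \<in> H. f y + f x0 \<in> U}"
    have "continuous_map (subtopology TG H) euclidean (\<lambda>y. f y + f x0)"
      using cont by (intro continuous_map_add) auto
    from openin_continuous_map_preimage[OF this U] have "openin (subtopology TG H) V"
      by (simp add: V_def top)
    then have "openin TG V" using H(1) openin_open_subtopology by blast
    from openin_continuous_map_preimage[OF continuous_map_translation[OF TG, of "- x0"] this]
    have "openin TG {x. x + - x0 \<in> V}" by (simp add: top)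
    moreover have "x0 \<in> {x. x + - x0 \<in> V}"
      using x0 H(2) by (simp add: V_def additive.zero[OF f])
    moreover have "{x. x + - x0 \<in> V} \<subseteq> {x \<in> topspace TG. f x \<in> U}"
      by (auto simp: V_def top additive.diff[OF f])
    ultimately show "\<exists>W. openin TG W \<and> x0 \<in> W \<and> W \<subseteq> {x \<in> topspace TG. f x \<in> U}" by blast
  qed
qed auto

section \<open>Construction of the coordinates from the structure of the group\<close>

text \<open>\<open>z\<close> and \<open>f\<close> are the components of the projection onto the
  quotient followed by the isomorphism, so their common kernel is \<open>G0\<close>. Each
  \<open>e i\<close> is a chosen lift of the \<open>i\<close>-th unit vector of the free
  part.\<close>

lemma quotient_coordinates:
  fixes G0 :: "'g::ab_group_add set" and F :: "'f monoid"
  assumes G0: "subgroup G0 add_grp" and F: "group F"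
    and quot: "(add_grp Mod G0) \<cong> (product_group {..<k} (\<lambda>_. integer_group) \<times>\<times> F)"
  obtains z :: "nat \<Rightarrow> 'g \<Rightarrow> int" and f :: "'g \<Rightarrow> 'f" and e :: "nat \<Rightarrow> 'g"
  where "\<And>j. j < k \<Longrightarrow> Modules.additive (z j)" "f \<in> hom add_grp F"
    "\<And>g. g \<in> G0 \<longleftrightarrow> (\<forall>j<k. z j g = 0) \<and> f g = \<one>\<^bsub>F\<^esub>"
    "\<And>i j. i < k \<Longrightarrow> j < k \<Longrightarrow> z j (e i) = (if i = j then 1 else 0)"
proof -
  let ?P = "product_group {..<k} (\<lambda>_. integer_group)"
  interpret G: comm_group "add_grp :: 'g monoid" by (rule comm_group_add_grp)
  interpret N: normal G0 "add_grp" by (rule G.subgroup_imp_normal[OF G0])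
  interpret F: group F by (rule F)
  have P: "group ?P" by (rule product_group) simp
  have PF: "group (?P \<times>\<times> F)" by (rule DirProd_group[OF P F])
  obtain \<psi> where \<psi>: "\<psi> \<in> iso (add_grp Mod G0) (?P \<times>\<times> F)"
    using quot by (auto simp: is_iso_def)
  define \<Phi> where "\<Phi> g = \<psi> (G0 #>\<^bsub>add_grp\<^esub> g)" for g
  have hom: "\<Phi> \<in> hom add_grp (?P \<times>\<times> F)"
    using hom_compose[OF N.r_coset_hom_Mod, of \<psi> "?P \<times>\<times> F"] \<psi>
    by (simp add: iso_def o_def \<Phi>_def[abs_def])
  have surj: "\<exists>g. \<Phi> g = y" if "y \<in> carrier (?P \<times>\<times> F)" for y
  proof -
    have "y \<in> \<psi> ` carrier (add_grp Mod G0)" using \<psi> that by (simp add: iso_def bij_betw_def)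
    moreover have "carrier (add_grp Mod G0) = range (\<lambda>g. G0 #>\<^bsub>add_grp\<^esub> g)"
      by (auto simp: FactGroup_def RCOSETS_def)
    ultimately show ?thesis by (auto simp: \<Phi>_def)
  qed
  have mem: "g \<in> G0 \<longleftrightarrow> \<Phi> g = \<one>\<^bsub>?P \<times>\<times> F\<^esub>" for g
  proof -
    have inj: "inj_on \<psi> (carrier (add_grp Mod G0))" using \<psi> by (auto simp: iso_def bij_betw_def)
    have one: "\<psi> G0 = \<one>\<^bsub>?P \<times>\<times> F\<^esub>"
      using hom_one[OF _ N.factorgroup_is_group PF, of \<psi>] \<psi> by (simp add: iso_def)
    have c: "G0 #>\<^bsub>add_grp\<^esub> g \<in> carrier (add_grp Mod G0)" "G0 \<in> carrier (add_grp Mod G0)"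
      using N.r_coset_hom_Mod group.is_monoid[OF N.factorgroup_is_group, THEN monoid.one_closed]
      by (auto simp: hom_def)
    have "\<Phi> g = \<one>\<^bsub>?P \<times>\<times> F\<^esub> \<longleftrightarrow> G0 #>\<^bsub>add_grp\<^esub> g = G0"
      unfolding \<Phi>_def one[symmetric] using inj c by (auto dest: inj_onD)
    also have "\<dots> \<longleftrightarrow> g \<in> G0"
      using G.coset_join1[of G0 g] G.coset_join2[of g G0] G0 by auto
    finally show ?thesis by simp
  qed
  have carr: "\<Phi> g \<in> carrier (?P \<times>\<times> F)" for g using hom by (auto simp: hom_def)
  have mult: "\<Phi> (g + h) = \<Phi> g \<otimes>\<^bsub>?P \<times>\<times> F\<^esub> \<Phi> h" for g h using hom by (auto simp: hom_def)
  define z where "z j g = fst (\<Phi> g) j" for j g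
  define f where "f g = snd (\<Phi> g)" for g
  define e where "e i = (SOME g. \<Phi> g = ((\<lambda>j\<in>{..<k}. if i = j then 1 else 0), \<one>\<^bsub>F\<^esub>))" for i
  have e: "\<Phi> (e i) = ((\<lambda>j\<in>{..<k}. if i = j then 1 else 0), \<one>\<^bsub>F\<^esub>)" for i
    unfolding e_def by (rule someI_ex, rule surj) (auto simp: DirProd_def carrier_product_group)
  show ?thesis
  proof
    show "Modules.additive (z j)" if "j < k" for j
      by unfold_locales (use that in \<open>simp add: z_def mult DirProd_def case_prod_beta product_group_def\<close>)
    show "f \<in> hom add_grp F"
      using carr by (auto simp: hom_def f_def mult DirProd_def case_prod_beta mem_Times_iff)
    show "g \<in> G0 \<longleftrightarrow> (\<forall>j<k. z j g = 0) \<and> f g = \<one>\<^bsub>F\<^esub>" for g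
    proof -
      have "fst (\<Phi> g) \<in> carrier ?P" using carr[of g] by (auto simp: DirProd_def)
      then have "fst (\<Phi> g) = \<one>\<^bsub>?P\<^esub> \<longleftrightarrow> (\<forall>j<k. z j g = 0)"
        unfolding z_def carrier_product_group by (auto simp: fun_eq_iff PiE_def extensional_def)
      then show ?thesis by (simp add: mem one_DirProd f_def prod_eq_iff)
    qed
    show "z j (e i) = (if i = j then 1 else 0)" if "i < k" "j < k" for i j
      using that by (simp add: z_def e)
  qed
qed

text \<open>The first \<open>k\<close> coordinates are the integers \<open>z i\<close>, with lines
  through the lifts \<open>e i\<close>. The other \<open>m\<close> extend the real coordinates of
  \<open>G0\<close>, with lines the axes of \<open>\<real>^m\<close> transported into
  \<open>G0\<close>.\<close>

lemma group_coordinates_exist: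
  fixes TG :: "'g::ab_group_add topology" and TK :: "'k::ab_group_add topology"
    and \<phi> :: "'g \<Rightarrow> (nat \<Rightarrow> real) \<times> 'k" and F :: "'f monoid" and k m :: nat
  assumes TG: "ab_top_group TG"
    and G0_sub: "subgroup G0 add_grp"
    and G0_open: "openin TG G0"
    and TK: "ab_top_group TK" "compact_space TK"
    and \<phi>_hom: "\<forall>x\<in>G0. \<forall>y\<in>G0. \<phi> (x + y) =
                  ((\<lambda>i. fst (\<phi> x) i + fst (\<phi> y) i), snd (\<phi> x) + snd (\<phi> y))"
    and \<phi>_homeo: "homeomorphic_map (subtopology TG G0)
                   (prod_topology (subtopology euclidean (Rpow m)) TK) \<phi>"
    and F: "group F"
    and F_torsion: "\<forall>x\<in>carrier F. \<exists>N::nat. N > 0 \<and> x [^]\<^bsub>F\<^esub> N = \<one>\<^bsub>F\<^esub>"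
    and quot: "(add_grp Mod G0) \<cong> (product_group {..<k} (\<lambda>_. integer_group) \<times>\<times> F)"
  shows "\<exists>D S \<theta> \<pi> K. group_coordinates TG D S \<theta> \<pi> K"
proof -
  let ?Y = "prod_topology (top_of_set (Rpow m)) TK"
  have topG: "topspace TG = UNIV" using TG unfolding ab_top_group_def by blast
  have topK: "topspace TK = UNIV" using TK(1) unfolding ab_top_group_def by blast
  obtain z :: "nat \<Rightarrow> 'g \<Rightarrow> int" and f :: "'g \<Rightarrow> 'f" and e :: "nat \<Rightarrow> 'g" where z: "\<And>j. j < k \<Longrightarrow> Modules.additive (z j)"
    and f: "f \<in> hom add_grp F"
    and G0: "\<And>g. g \<in> G0 \<longleftrightarrow> (\<forall>j<k. z j g = 0) \<and> f g = \<one>\<^bsub>F\<^esub>"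
    and e: "\<And>i j. i < k \<Longrightarrow> j < k \<Longrightarrow> z j (e i) = (if i = j then 1 else 0)"
    by (rule quotient_coordinates[OF G0_sub F quot]) (rule that)
  obtain \<psi> where \<psi>: "homeomorphic_maps (subtopology TG G0) ?Y \<phi> \<psi>"
    using \<phi>_homeo homeomorphic_map_maps by blast
  have \<phi>_cont: "continuous_map (subtopology TG G0) ?Y \<phi>"
    and \<psi>_cont: "continuous_map ?Y (subtopology TG G0) \<psi>"
    and \<psi>\<phi>: "\<And>x. x \<in> G0 \<Longrightarrow> \<psi> (\<phi> x) = x"
    and \<phi>\<psi>: "\<And>v \<kappa>. v \<in> Rpow m \<Longrightarrow> \<phi> (\<psi> (v, \<kappa>)) = (v, \<kappa>)"
    using \<psi> by (auto simp: homeomorphic_maps_def topG topK)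
  have \<psi>_mem: "\<psi> (v, \<kappa>) \<in> G0" if "v \<in> Rpow m" for v \<kappa>
    using continuous_map_image_subset_topspace[OF \<psi>_cont] that by (auto simp: topG topK)
  have \<phi>_Rpow: "fst (\<phi> x) \<in> Rpow m" if "x \<in> G0" for x
    using continuous_map_image_subset_topspace[OF \<phi>_cont] that by (auto simp: topG topK image_subset_iff mem_Times_iff)
  define \<rho> where "\<rho> i x = fst (\<phi> x) i" for i x
  have \<rho>: "subgroup_real_hom G0 (\<rho> i)" for i
    using G0_sub \<phi>_hom by (intro subgroup_real_hom.intro) (auto simp: \<rho>_def)
  note \<rho>_0 = subgroup_real_hom.zero_mem[OF \<rho>]
  have \<rho>_cont: "continuous_map (subtopology TG G0) euclidean (\<rho> i)" for i
  proof -
    have a: "continuous_map (subtopology TG G0) (top_of_set (Rpow m)) (\<lambda>x. fst (\<phi> x))"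
      using continuous_map_compose[OF \<phi>_cont continuous_map_fst] by (simp add: o_def)
    have b: "continuous_map (top_of_set (Rpow m)) euclidean (\<lambda>v. v i)"
      using continuous_on_subset[OF continuous_on_product_coordinates subset_UNIV] by simp
    from continuous_map_compose[OF a b] show ?thesis by (simp add: o_def \<rho>_def[abs_def])
  qed
  \<comment> \<open>Removing the free part leaves an element whose image in the quotient lies in
    \<open>F\<close>, so that a positive multiple of it falls into \<open>G0\<close>.\<close>
  define u where "u g = g - (\<Sum>i<k. intmul (z i g) (e i))" for g
  have u: "Modules.additive u"
    by unfold_locales (auto simp: u_def additive.add[OF z] intmul_add sum.distrib)
  have z_u: "z j (u g) = 0" if "j < k" for j g
  proof -
    have "z j (u g) = z j g - (\<Sum>i<k. if i = j then z i g else 0)"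
      unfolding u_def additive.diff[OF z[OF that]] additive.sum[OF z[OF that]] additive.intmul[OF z[OF that]]
      by (intro arg_cong2[where f = "(-)"] sum.cong) (auto simp: e that)
    then show ?thesis using that by simp
  qed
  have tor: "\<exists>N>0. natmul N (u g) \<in> G0" for g
  proof -
    have "f (u g) \<in> carrier F" using f by (auto simp: hom_def)
    then obtain N :: nat where N: "N > 0" "f (u g) [^]\<^bsub>F\<^esub> N = \<one>\<^bsub>F\<^esub>" using F_torsion by blast
    have "f (natmul N (u g)) = f (u g) [^]\<^bsub>F\<^esub> N"
      using hom_nat_pow[OF f, of "u g" N] F
      by (simp add: nat_pow_add_grp comm_group.axioms(2)[OF comm_group_add_grp])
    then show ?thesis using N z_u by (auto simp: G0 additive.natmul[OF z])
  qed
  have "\<exists>r. Modules.additive r \<and>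
      (\<forall>g N. N > 0 \<longrightarrow> natmul N (u g) \<in> G0 \<longrightarrow> r g = \<rho> i (natmul N (u g)) / real N)" for i
    by (rule subgroup_real_hom.torsion_extension[OF \<rho> u tor]) blast
  then obtain r where r_add: "\<And>i. Modules.additive (r i)"
    and r: "\<And>i g N. N > 0 \<Longrightarrow> natmul N (u g) \<in> G0 \<Longrightarrow> r i g = \<rho> i (natmul N (u g)) / real N"
    by metis
  \<comment> \<open>On \<open>G0\<close> the multiple \<open>N = 1\<close> is admissible, so
    \<open>r i\<close> restricts to \<open>\<rho> i\<close> there and inherits its
    continuity.\<close>
  have u_G0: "u g = g" if "g \<in> G0" for g
    using that G0 by (simp add: u_def intmul_def)
  have r_cont: "continuous_map TG euclidean (r i)" for i
  proof (rule continuous_map_additive_open_subgroup[OF TG G0_open \<rho>_0 r_add])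
    have "r i g = \<rho> i g" if "g \<in> G0" for g
      using r[of 1 g i] that u_G0 by simp
    then show "continuous_map (subtopology TG G0) euclidean (r i)"
      using \<rho>_cont[of i] by (auto intro: continuous_map_eq simp: topG)
  qed
  have z_cont: "continuous_map TG euclidean (\<lambda>g. real_of_int (z i g))"
    and z_real: "Modules.additive (\<lambda>g. real_of_int (z i g))" if "i < k" for i
  proof -
    show a: "Modules.additive (\<lambda>g. real_of_int (z i g))"
      by unfold_locales (simp add: additive.add[OF z[OF that]])
    show "continuous_map TG euclidean (\<lambda>g. real_of_int (z i g))"
    proof (rule continuous_map_additive_open_subgroup[OF TG G0_open \<rho>_0 a])
      \<comment> \<open>The integer coordinates vanish on the open subgroup
        \<open>G0\<close>.\<close>
      have "continuous_map (subtopology TG G0) euclidean (\<lambda>g. 0 :: real)" by simp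
      then show "continuous_map (subtopology TG G0) euclidean (\<lambda>g. real_of_int (z i g))"
        by (rule continuous_map_eq) (use that G0 in auto)
    qed
  qed
  define line where "line i s = (\<lambda>j. if j = i then s else 0)" for i :: nat and s :: real
  have line: "line i s \<in> Rpow m" if "i < m" for i s using that by (auto simp: line_def Rpow_def)
  have line_add: "\<psi> (line i (x + y), 0) = \<psi> (line i x, 0) + \<psi> (line i y, 0)" if "i < m" for i x y
  proof -
    have *: "\<psi> (line i x, 0) \<in> G0" "\<psi> (line i y, 0) \<in> G0" using \<psi>_mem line that by auto
    then have "\<phi> (\<psi> (line i x, 0) + \<psi> (line i y, 0)) = (line i (x + y), 0)"
      using \<phi>_hom \<phi>\<psi> line[OF that] by (auto simp: line_def fun_eq_iff)
    \<comment> \<open>Both sides lie in \<open>G0\<close> and have the same image under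
      \<open>\<phi>\<close>; applying \<open>\<psi>\<close> identifies them.\<close>
    then show ?thesis
      using \<psi>\<phi>[OF subgroup_real_hom.add_mem[OF \<rho> *]] by simp
  qed
  have line_cont: "continuous_map euclidean TG (\<lambda>s. \<psi> (line i s, 0))" if "i < m" for i
  proof -
    have "continuous_on UNIV (line i)"
    proof (intro continuous_on_coordinatewise_then_product)
      show "continuous_on UNIV (\<lambda>s. line i s j)" for j by (cases "j = i") (simp_all add: line_def)
    qed
    then have "continuous_map euclidean (top_of_set (Rpow m)) (line i)"
      using line[OF that] by (auto simp: continuous_map_in_subtopology)
    then have "continuous_map euclidean ?Y (\<lambda>s. (line i s, 0))"
      by (intro continuous_map_pairedI) (auto simp: topK)
    from continuous_map_compose[OF this \<psi>_cont] show ?thesis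
      by (auto simp: o_def continuous_map_in_subtopology)
  qed
  \<comment> \<open>This is the copy in \<open>G0\<close> of the compact factor, as the next
    equation shows.\<close>
  define K where "K = {x \<in> G0. \<forall>i. \<rho> i x = 0}"
  have "K = \<psi> ` ({\<lambda>_. 0} \<times> UNIV)"
  proof
    show "K \<subseteq> \<psi> ` ({\<lambda>_. 0} \<times> UNIV)"
    proof
      fix x assume "x \<in> K"
      then have "fst (\<phi> x) = (\<lambda>_. 0)" "x \<in> G0" by (auto simp: K_def \<rho>_def)
      then show "x \<in> \<psi> ` ({\<lambda>_. 0} \<times> UNIV)"
        using \<psi>\<phi>[of x] by (intro image_eqI[of _ _ "\<phi> x"]) (auto simp: mem_Times_iff)
    qed
    have "(\<lambda>_. 0) \<in> Rpow m" by (simp add: Rpow_def)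
    then show "\<psi> ` ({\<lambda>_. 0} \<times> UNIV) \<subseteq> K" using \<psi>_mem \<phi>\<psi> by (auto simp: K_def \<rho>_def)
  qed
  moreover have "compactin ?Y ({\<lambda>_. 0} \<times> UNIV)"
    using TK(2) topK by (auto simp: compactin_Times compact_space_def Rpow_def)
  ultimately have "compactin (subtopology TG G0) K"
    using image_compactin[OF _ \<psi>_cont] by auto
  then have K_compact: "compactin TG K" by (simp add: compactin_subtopology)
  define S where "S i = (if i < k then \<int> else (UNIV :: real set))" for i
  \<comment> \<open>For \<open>i < k\<close> the argument is an integer stored as a real, and the
    floor recovers it; the real lines are numbered from \<open>k\<close> on.\<close>
  define \<theta> where "\<theta> i = (if i < k then (\<lambda>s. intmul \<lfloor>s\<rfloor> (e i)) else (\<lambda>s. \<psi> (line (i - k) s, 0)))" for i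
  define \<pi> where "\<pi> i = (if i < k then (\<lambda>g. real_of_int (z i g)) else r (i - k))" for i
  have "group_coordinates TG (k + m) S \<theta> \<pi> K"
  proof (rule group_coordinates.intro)
    show "ab_top_group TG" by (rule TG)
    show "S i = \<int> \<or> S i = UNIV" for i by (simp add: S_def)
    show "\<theta> i (x + y) = \<theta> i x + \<theta> i y" if "i < k + m" "x \<in> S i" "y \<in> S i" for i x y
      using that by (auto simp: \<theta>_def S_def intmul_add line_add elim!: Ints_cases simp flip: of_int_add split: if_splits)
    show "continuous_map (top_of_set (S i)) TG (\<theta> i)" if "i < k + m" for i
    proof (cases "i < k")
      case True
      \<comment> \<open>The integers are discrete, so every map on them is continuous.\<close>
      have "openin (top_of_set \<int>) {x}" if "x \<in> \<int>" for x :: real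
      proof -
        have "{x} = \<int> \<inter> {x - 1<..<x + 1}" using that by (auto elim!: Ints_cases)
        moreover have "openin (top_of_set \<int>) (\<int> \<inter> {x - 1<..<x + 1})" by (intro openin_open_Int) simp
        ultimately show ?thesis by (simp only:)
      qed
      then have "subtopology euclidean (\<int> :: real set) = discrete_topology \<int>"
        by (intro discrete_topology_unique[THEN iffD2, symmetric]) auto
      then show ?thesis using True by (simp add: S_def topG)
    next
      case False
      then show ?thesis using that line_cont[of "i - k"] by (simp add: S_def \<theta>_def)
    qed
    show "Modules.additive (\<pi> i)" "continuous_map TG euclidean (\<pi> i)" if "i < k + m" for i
      using z_real[of i] z_cont[of i] r_add[of "i - k"] r_cont[of "i - k"] by (simp_all add: \<pi>_def)
    show "\<pi> i g \<in> S i" for i g by (simp add: \<pi>_def S_def)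
    show "compactin TG K" by (rule K_compact)
    show "natmul i x \<in> K" if "x \<in> K" for x i
      using that subgroup_real_hom.hom_natmul[OF \<rho>] by (auto simp: K_def)
    show "\<exists>N>0. natmul N (g - (\<Sum>i<k + m. \<theta> i (\<pi> i g))) \<in> K" for g
    proof -
      obtain N where N: "N > 0" "natmul N (u g) \<in> G0" using tor by blast
      \<comment> \<open>\<open>v\<close> lies in \<open>G0\<close> and has the real coordinates
        \<open>r i g\<close>. Since \<open>u g\<close> need not lie in \<open>G0\<close>, the two
        are compared only after multiplication by \<open>N\<close>.\<close>
      define v where "v = (\<Sum>i<m. \<psi> (line i (r i g), 0))"
      have split: "(\<Sum>i<k + d. h i) = (\<Sum>i<k. h i) + (\<Sum>i<d. h (k + i))" for d and h :: "nat \<Rightarrow> 'g"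
        by (induction d) (simp_all add: add.assoc)
      have "(\<Sum>i<k + m. \<theta> i (\<pi> i g)) = (\<Sum>i<k. intmul (z i g) (e i)) + v"
        unfolding split v_def by (simp add: \<theta>_def \<pi>_def)
      then have uv: "g - (\<Sum>i<k + m. \<theta> i (\<pi> i g)) = u g - v" by (simp add: u_def)
      have v: "v \<in> G0 \<and> \<rho> j v = (\<Sum>i<m. \<rho> j (\<psi> (line i (r i g), 0)))" for j
        unfolding v_def by (rule subgroup_real_hom.hom_sum[OF \<rho>]) (use \<psi>_mem line in auto)
      have \<rho>_v: "\<rho> j v = (if j < m then r j g else 0)" for j
      proof -
        have "\<rho> j (\<psi> (line i (r i g), 0)) = (if j = i then r j g else 0)" if "i < m" for i
          unfolding \<rho>_def \<phi>\<psi>[OF line[OF that]] by (simp add: line_def)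
        then show ?thesis using v[of j] by simp
      qed
      have Nv: "natmul N v \<in> G0" "\<rho> j (natmul N v) = real N * \<rho> j v" for j
        using subgroup_real_hom.hom_natmul[OF \<rho>] v by auto
      \<comment> \<open>For \<open>j < m\<close> this is the defining property of
        \<open>r j\<close>; for larger \<open>j\<close> both sides are 0, as \<open>\<phi>\<close>
        takes values in \<open>Rpow m\<close>.\<close>
      have "\<rho> j (natmul N (u g)) = real N * \<rho> j v" for j
      proof (cases "j < m")
        case True
        then show ?thesis using r[OF N, of j] N by (simp add: \<rho>_v)
      next
        case False
        then have "\<rho> j (natmul N (u g)) = 0" using \<phi>_Rpow[OF N(2)] by (simp add: \<rho>_def Rpow_def)
        then show ?thesis using False by (simp add: \<rho>_v)
      qed
      then have "natmul N (u g - v) \<in> K"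
        unfolding K_def natmul_diff_right
        using subgroup_real_hom.hom_diff[OF \<rho> N(2) Nv(1)] Nv by auto
      then show ?thesis using N uv by metis
    qed
  qed
  then show ?thesis by blast
qed

section \<open>Finite dimensionality and the separated form of differences\<close>

theorem theorem3p4:
  fixes TG :: "'g::ab_group_add topology"
    and G0 :: "'g set"
    and m :: nat
    and TK :: "'k::ab_group_add topology"
    and \<phi> :: "'g \<Rightarrow> (nat \<Rightarrow> real) \<times> 'k"
    and k :: nat
    and F :: "'f monoid"
    and TX :: "'x::ab_group_add topology"
    and sm :: "complex \<Rightarrow> 'x \<Rightarrow> 'x"
  assumes G_top: "ab_top_group TG"
    and G_lc: "locally_compact_space TG"
    and G0_sub: "subgroup G0 add_grp"
    and G0_open: "openin TG G0"
    and K_top: "ab_top_group TK"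
    and K_compact: "compact_space TK"
    and \<phi>_hom: "\<forall>x\<in>G0. \<forall>y\<in>G0. \<phi> (x + y) =
                  ((\<lambda>i. fst (\<phi> x) i + fst (\<phi> y) i), snd (\<phi> x) + snd (\<phi> y))"
    and \<phi>_homeo: "homeomorphic_map (subtopology TG G0)
                   (prod_topology (subtopology euclidean (Rpow m)) TK) \<phi>"
    and F_group: "group F"
    and F_torsion: "\<forall>x\<in>carrier F. \<exists>N::nat. N > 0 \<and> x [^]\<^bsub>F\<^esub> N = \<one>\<^bsub>F\<^esub>"
    and quot: "(add_grp Mod G0) \<cong> (product_group {..<k} (\<lambda>_. integer_group) \<times>\<times> F)"
    and X_lctvs: "locally_convex_tvs TX sm"
  shows "(\<forall>n. \<exists>B. finite B \<and>
             (\<forall>p\<in>scalar_poly_space TG n. \<exists>c. \<forall>x. p x = (\<Sum>b\<in>B. c b * b x)))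
       \<and> ((\<exists>N::nat. N > 0 \<and> (\<forall>x\<in>carrier F. x [^]\<^bsub>F\<^esub> N = \<one>\<^bsub>F\<^esub>)) \<longrightarrow>
          (\<forall>n. \<forall>p\<in>poly_space TG TX sm n.
             \<exists>(l::nat) (ps::nat \<Rightarrow> 'g \<Rightarrow> 'x) (qs::nat \<Rightarrow> 'g \<Rightarrow> complex).
               (\<forall>j<l. ps j \<in> poly_space TG TX sm n) \<and>
               (\<forall>j<l. qs j \<in> scalar_poly_space TG n \<and> qs j 0 = 0) \<and>
               (\<forall>h t. p (t + h) - p t = (\<Sum>j<l. sm (qs j h) (ps j t)))))"
proof -
  obtain D S \<theta> \<pi> K where "group_coordinates TG D S \<theta> \<pi> K"
    using group_coordinates_exist[OF G_top G0_sub G0_open K_top K_compact \<phi>_hom \<phi>_homeo F_group F_torsion quot]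
    by blast
  then interpret G: group_coordinates TG D S \<theta> \<pi> K .
  interpret X: tvs_group_coordinates TX sm TG D S \<theta> \<pi> K
    using X_lctvs by unfold_locales (auto simp: locally_convex_tvs_def)
  have plus: "continuous_map (prod_topology euclidean euclidean) euclidean (\<lambda>(a, x). a + x :: complex)"
    unfolding case_prod_beta
    by (intro continuous_map_add continuous_map_fst continuous_map_snd)
  \<comment> \<open>The complex numbers as target space, for the scalar polynomials in (a).\<close>
  interpret C: tvs_group_coordinates euclidean "(*) :: complex \<Rightarrow> _" TG D S \<theta> \<pi> K
    using continuous_map_mult_complex plus by unfold_locales (auto simp: complex_vs_def algebra_simps)
  show ?thesis
  proof (intro conjI allI impI ballI)
    fix n
    let ?I = "exponents n D"
    show "\<exists>B. finite B \<and> (\<forall>p\<in>scalar_poly_space TG n. \<exists>c. \<forall>x. p x = (\<Sum>b\<in>B. c b * b x))"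
    \<comment> \<open>The monomials may have total degree above \<open>n\<close>; it suffices that
      their finite-dimensional span contains all scalar polynomials of degree at most
      \<open>n\<close>.\<close>
    proof (intro exI[of _ "G.coord_monomial ` ?I"] conjI ballI)
      show "finite (G.coord_monomial ` ?I)" using finite_exponents by blast
      fix p assume "p \<in> scalar_poly_space TG n"
      then obtain x where "\<And>t h. p (t + h) = (\<Sum>b\<in>?I. G.coord_monomial b h * x b t)"
        using C.poly_expansion by blast
      from this[of 0] have x: "p h = (\<Sum>b\<in>?I. G.coord_monomial b h * x b 0)" for h by simp
      \<comment> \<open>Several multi-indices might give the same function, so the coefficient of a
        function sums over all multi-indices producing it.\<close>
      have "p h = (\<Sum>q\<in>G.coord_monomial ` ?I. (\<Sum>b | b \<in> ?I \<and> G.coord_monomial b = q. x b 0) * q h)" for h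
        unfolding x sum.image_gen[OF finite_exponents, of "\<lambda>b. G.coord_monomial b h * x b 0" _ _ "G.coord_monomial"] sum_distrib_right
        by (intro sum.cong) (auto simp: mult.commute)
      then show "\<exists>c. \<forall>x. p x = (\<Sum>b\<in>G.coord_monomial ` ?I. c b * b x)"
        by (intro exI[of _ "\<lambda>q. \<Sum>b | b \<in> ?I \<and> G.coord_monomial b = q. x b 0"]) simp
    qed
  next
    fix n p assume p: "p \<in> poly_space TG TX sm n"
    \<comment> \<open>Positive total degree makes the monomial vanish at 0; total degree at most
      \<open>n\<close> makes it a polynomial of degree at most \<open>n\<close>.\<close>
    define J where "J = {b. b \<in> exponents n D \<and> 0 < (\<Sum>i<D. b ! i) \<and> (\<Sum>i<D. b ! i) \<le> n}"
    obtain x where x: "\<And>b. b \<in> J \<Longrightarrow> x b \<in> poly_space TG TX sm n"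
      and px: "\<And>t h. p (t + h) - p t = (\<Sum>b\<in>J. sm (G.coord_monomial b h) (x b t))"
      using X.poly_difference_expansion[OF p] unfolding J_def by blast
    have "finite J" unfolding J_def using finite_exponents[of n D] by (rule rev_finite_subset) auto
    then obtain \<beta> where \<beta>: "bij_betw \<beta> {..<card J} J"
      using ex_bij_betw_nat_finite[of J] by (auto simp: atLeast0LessThan)
    have \<beta>J: "\<beta> j \<in> J" if "j < card J" for j using \<beta> that by (auto simp: bij_betw_def)
    show "\<exists>(l::nat) (ps::nat \<Rightarrow> 'g \<Rightarrow> 'x) (qs::nat \<Rightarrow> 'g \<Rightarrow> complex). (\<forall>j<l. ps j \<in> poly_space TG TX sm n) \<and>
        (\<forall>j<l. qs j \<in> scalar_poly_space TG n \<and> qs j 0 = 0) \<and>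
        (\<forall>h t. p (t + h) - p t = (\<Sum>j<l. sm (qs j h) (ps j t)))"
    proof (intro exI[of _ "card J"] exI[of _ "\<lambda>j. x (\<beta> j)"] exI[of _ "\<lambda>j. G.coord_monomial (\<beta> j)"] conjI allI impI)
      show "x (\<beta> j) \<in> poly_space TG TX sm n" if "j < card J" for j using x \<beta>J[OF that] .
      show "G.coord_monomial (\<beta> j) \<in> scalar_poly_space TG n" "G.coord_monomial (\<beta> j) 0 = 0" if "j < card J" for j
        using \<beta>J[OF that] G.coord_monomial_poly_space by (auto simp: J_def G.coord_monomial_0 simp del: sum_eq_0_iff)
      show "p (t + h) - p t = (\<Sum>j<card J. sm (G.coord_monomial (\<beta> j) h) (x (\<beta> j) t))" for h t
        unfolding px by (rule sum.reindex_bij_betw[OF \<beta>, symmetric])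
    qed
  qed
qed

end
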